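(* Let $T>0$ and $\lambda>0$. Suppose bidders enter an auction on $[0,T]$ according to a homogeneous Poisson process of rate $\lambda$, and that a bidder who arrives at time $s$ places a single bid, at a random time in $[s,T)$ with distribution function $G_s$; conditionally on the arrival times, the bid times of different bidders are independent. Then the bid arrival process has independent increments on $[0,T]$ (the bid counts on nonoverlapping subintervals of $[0,T]$ are independent), and for each $y\in[0,T]$ the number of bids placed in $[0,y]$ is Poisson distributed with mean $\int_0^y \lambda\, G_s(y)\,ds$. Moreover, if each $G_s$ has a derivative (density) $g_s$, then the bid arrival process is a nonhomogeneous Poisson process with intensity function $$\lambda(t)=\lambda\int_0^t g_s(t)\,ds,\qquad 0\le t\le T .$$
   Context: A nonhomogeneous Poisson process on $[0,T]$ with intensity function $\lambda(\cdot)$ is a counting process with independent increments such that the number of points in any interval $(u,v]$ is Poisson distributed with mean $\int_u^v\lambda(t)\,dt$. The family $(G_s)_{0\le s\le T}$ is assumed to depend measurably on $s$; $G_s(y)=0$ for $y<s$, and $G_s$ is a probability distribution function supported on $[s,T)$. When the densities $g_s$ exist, $(s,t)\mapsto g_s(t)$ is taken jointly measurable and $G_s(y)=\int_s^y g_s(t)\,dt$. *)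

theory Defs
  imports "HOL-Probability.Probability"
begin

text \<open>
  A random finite set of points is given by the number \<open>K\<close> of points and their
  positions \<open>X 0, \<dots>, X (K - 1)\<close>; the values \<open>X i\<close> with \<open>i \<ge> K\<close> are meaningless and are
  never used. The points need not be listed in increasing order.
\<close>

definition point_count ::
  "('a \<Rightarrow> nat) \<Rightarrow> (nat \<Rightarrow> 'a \<Rightarrow> real) \<Rightarrow> real set \<Rightarrow> 'a \<Rightarrow> nat" where
  "point_count K X J \<omega> = card {i. i < K \<omega> \<and> X i \<omega> \<in> J}"

text \<open>
  The intervals may be open, half-open, closed or degenerate. Nonoverlapping is read as
  disjoint, since a common endpoint may carry points with positive probability.
\<close>

definition independent_increments ::
  "'a measure \<Rightarrow> real \<Rightarrow> (real set \<Rightarrow> 'a \<Rightarrow> nat) \<Rightarrow> bool" where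
  "independent_increments M T N \<longleftrightarrow>
    (\<forall>n (J :: nat \<Rightarrow> real set).
      (\<forall>i<n. is_interval (J i) \<and> J i \<subseteq> {0..T}) \<and> disjoint_family_on J {..<n} \<longrightarrow>
      prob_space.indep_vars M (\<lambda>_. count_space UNIV) (\<lambda>i. N (J i)) {..<n})"

text \<open>
  The library's \<open>poisson_pmf\<close> is only specified for a positive rate; here the mean may be zero,
  in which case the distribution is the point mass at zero (note \<open>0 ^ 0 = 1\<close>).
\<close>

definition poisson_distributed :: "'a measure \<Rightarrow> ('a \<Rightarrow> nat) \<Rightarrow> real \<Rightarrow> bool" where
  "poisson_distributed M X m \<longleftrightarrow>
    X \<in> measurable M (count_space UNIV) \<and> 0 \<le> m \<and>
    (\<forall>k. measure M {\<omega> \<in> space M. X \<omega> = k} = m ^ k / fact k * exp (- m))"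

text \<open>
  The Bochner integral of a non-integrable function is zero, so integrability of the intensity
  is required explicitly. The intervals \<open>{u<..v}\<close> do not see the time \<open>0\<close>; that
  a counting process starts at zero is the third conjunct.
\<close>

definition poisson_process ::
  "'a measure \<Rightarrow> real \<Rightarrow> (real \<Rightarrow> real) \<Rightarrow> (real set \<Rightarrow> 'a \<Rightarrow> nat) \<Rightarrow> bool" where
  "poisson_process M T l N \<longleftrightarrow>
    (\<forall>t\<in>{0..T}. 0 \<le> l t) \<and> set_integrable lborel {0..T} l \<and>
    (AE \<omega> in M. N {0} \<omega> = 0) \<and>
    independent_increments M T N \<and>
    (\<forall>u v. 0 \<le> u \<and> u \<le> v \<and> v \<le> T \<longrightarrow>
      poisson_distributed M (N {u<..v}) (LINT t:{u..v}|lborel. l t))"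

text \<open>
  The index \<open>s = T\<close> is left out because no distribution is supported on the empty
  set \<open>{T..<T}\<close>; the value of \<open>G T\<close> is irrelevant.
\<close>

definition bid_time_cdfs :: "real \<Rightarrow> (real \<Rightarrow> real \<Rightarrow> real) \<Rightarrow> bool" where
  "bid_time_cdfs T G \<longleftrightarrow>
    (\<forall>s\<in>{0..<T}. \<exists>\<mu>. real_distribution \<mu> \<and> measure \<mu> {s..<T} = 1 \<and> G s = cdf \<mu>) \<and>
    (\<forall>y. (\<lambda>s. G s y) \<in> borel_measurable (restrict_space borel {0..<T}))"

definition bid_time_densities ::
  "real \<Rightarrow> (real \<Rightarrow> real \<Rightarrow> real) \<Rightarrow> (real \<Rightarrow> real \<Rightarrow> real) \<Rightarrow> bool" where
  "bid_time_densities T G g \<longleftrightarrow>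
    (\<lambda>(s, t). g s t) \<in> borel_measurable (restrict_space (borel \<Otimes>\<^sub>M borel) ({0..T} \<times> {0..T})) \<and>
    (\<forall>s\<in>{0..<T}.
      (\<forall>t\<in>{s..T}. 0 \<le> g s t) \<and> set_integrable lborel {s..T} (g s) \<and>
      (\<forall>y\<in>{s..T}. G s y = (LINT t:{s..y}|lborel. g s t)))"

text \<open>
  The information contained in the arrival times \<open>S i\<close>, \<open>i < K\<close>. Taking \<open>A = UNIV\<close>
  shows that it includes \<open>K\<close>; the meaningless values \<open>S i\<close> with \<open>i \<ge> K\<close> do not enter.
\<close>

definition arrival_sigma ::
  "'a measure \<Rightarrow> ('a \<Rightarrow> nat) \<Rightarrow> (nat \<Rightarrow> 'a \<Rightarrow> real) \<Rightarrow> 'a measure" where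
  "arrival_sigma M K S =
    sigma (space M) {{\<omega> \<in> space M. i < K \<omega> \<and> S i \<omega> \<in> A} | i A. A \<in> sets borel}"

text \<open>
  Given the arrival times, the joint distribution function of the bid times is the product of
  the distribution functions \<open>G (S i)\<close>: the bid times are conditionally independent and the
  one of bidder \<open>i\<close> has distribution function \<open>G (S i)\<close>. On the event \<open>K = n\<close>
  only \<open>y 0, \<dots>, y (n - 1)\<close> matter.
\<close>

definition conditionally_independent_bids ::
  "'a measure \<Rightarrow> ('a \<Rightarrow> nat) \<Rightarrow> (nat \<Rightarrow> 'a \<Rightarrow> real) \<Rightarrow> (nat \<Rightarrow> 'a \<Rightarrow> real)
    \<Rightarrow> (real \<Rightarrow> real \<Rightarrow> real) \<Rightarrow> bool" where
  "conditionally_independent_bids M K S B G \<longleftrightarrow>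
    (\<forall>y :: nat \<Rightarrow> real. AE \<omega> in M.
      real_cond_exp M (arrival_sigma M K S)
        (indicator {\<omega> \<in> space M. \<forall>i<K \<omega>. B i \<omega> \<le> y i}) \<omega>
      = (\<Prod>i<K \<omega>. G (S i \<omega>) (y i)))"

end

theory Submission
  imports Defs
begin

text \<open>
  For Borel \<open>h\<close> with values in \<open>[0, 1]\<close>, conditioning on the arrival times gives
  \<open>E (\<Prod>i<K. h (B i)) = E (\<Prod>i<K. f (S i))\<close> with \<open>f s = \<integral> h dG\<^sub>s\<close>, and for a Poisson process the
  right-hand side is \<open>exp (- \<lambda> \<integral>\<^bsub>[0,T]\<^esub> (1 - f))\<close>. When \<open>h\<close> equals \<open>z j\<close> on disjoint sets
  \<open>A j\<close> and \<open>1\<close> elsewhere, the left-hand side is the joint probability generating function of the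
  counts of bids in the \<open>A j\<close>, while \<open>1 - f s = \<Sum>j. (1 - z j) * G\<^sub>s (A j)\<close>. Hence the generating
  function is a product of Poisson generating functions with means \<open>\<lambda> \<integral>\<^bsub>[0,T]\<^esub> G\<^sub>s (A j) ds\<close>, which
  gives independence and the marginal laws at once.
\<close>

section \<open>Probability generating functions\<close>

text \<open>The hypotheses speak only of counts in intervals: no joint law of \<open>K\<close> and
  the \<open>S i\<close> is given, and the points come in no particular order, so treating the
  arrivals as uniform given \<open>K = n\<close> is not directly available. A product over all
  points is symmetric in them and avoids the ordering. The Poisson formula is immediate for step
  functions \<open>f\<close>, but the \<open>f\<close> that is needed is only Borel in
  \<open>s\<close>, because \<open>G\<close> is. The formula is not linear in \<open>f\<close>, so
  linear combinations are of no use; the class of admissible \<open>f\<close> is enlarged by limits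
  alone, from step to continuous to Borel functions. The last passage converges only outside a
  Lebesgue null set, which all arrivals must avoid; this is why their intensity measure is computed.
  Two time points need separate care: 0, which no \<open>{u<..v}\<close> contains, and
  \<open>T\<close>, where \<open>G T\<close> is arbitrary.\<close>

lemma powser_coeff_zero:
  fixes c :: "nat \<Rightarrow> real"
  assumes "\<And>z. 0 < z \<Longrightarrow> z < 1 \<Longrightarrow> (\<lambda>k. c k * z ^ k) sums 0"
  shows "c n = 0"
\<comment> \<open>Once the coefficients below \<open>n\<close> vanish, dividing by
  \<open>z ^ n\<close> leaves a series with constant term \<open>c n\<close>; its sum is 0 on (0,
  1), and letting \<open>z\<close> tend to 0 from the right gives the claim.\<close>
proof (induction n rule: less_induct)
  case (less n)
  \<comment> \<open>The hypothesis covers positive arguments only, whereas the limit at 0 wants a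
    full disc; convergence at a positive \<open>w\<close> gives it for all \<open>x\<close> of
    smaller modulus.\<close>
  have summ: "summable (\<lambda>k. c (k + n) * x ^ k)" if x: "norm x < 1" for x :: real
  proof -
    obtain w where w: "norm x < w" "w < 1" using dense[OF x] by auto
    then have "0 < w" using norm_ge_zero[of x] by linarith
    then have "summable (\<lambda>k. c k * w ^ k)"
      using assms[of w] w by (auto simp: sums_iff)
    then have "summable (\<lambda>k. c (k + n) * w ^ (k + n))"
      by (subst summable_iff_shift)
    then have "summable (\<lambda>k. inverse (w ^ n) * (c (k + n) * w ^ (k + n)))"
      by (rule summable_mult)
    then have "summable (\<lambda>k. c (k + n) * w ^ k)"
      using \<open>0 < w\<close> by (simp add: power_add field_simps)
    then show ?thesis by (rule powser_inside) (use w \<open>0 < w\<close> in auto)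
  qed
  define f where "f x = (\<Sum>k. c (k + n) * x ^ k)" for x :: real
  have f0: "f x = 0" if x: "0 < x" "x < 1" for x
  proof -
    have "(\<lambda>k. c (k + n) * x ^ (k + n)) sums 0"
      using assms[OF x] less by (subst sums_iff_shift) auto
    then have "(\<lambda>k. inverse (x ^ n) * (c (k + n) * x ^ (k + n))) sums (inverse (x ^ n) * 0)"
      by (rule sums_mult)
    then have "(\<lambda>k. c (k + n) * x ^ k) sums 0"
      using x by (simp add: power_add field_simps)
    then show ?thesis by (simp add: f_def sums_iff)
  qed
  have "(f \<longlongrightarrow> c (0 + n)) (at 0)"
    by (rule powser_limit_0[of 1]) (use summ in \<open>auto simp: f_def summable_sums\<close>)
  then have 1: "(f \<longlongrightarrow> c n) (at_right 0)"
    by (simp add: filterlim_at_split)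
  have "eventually (\<lambda>x::real. f x = 0) (at_right 0)"
    by (rule eventually_at_rightI[of 0 1]) (use f0 in auto)
  then have "(f \<longlongrightarrow> 0) (at_right 0)"
    by (rule tendsto_eventually)
  then show ?case using tendsto_unique[OF _ 1] by auto
qed

lemma powser_coeff_eqI:
  fixes a b :: "nat \<Rightarrow> real"
  assumes "\<And>z. 0 < z \<Longrightarrow> z < 1 \<Longrightarrow> (\<lambda>k. a k * z ^ k) sums f z"
    and "\<And>z. 0 < z \<Longrightarrow> z < 1 \<Longrightarrow> (\<lambda>k. b k * z ^ k) sums f z"
  shows "a n = b n"
proof -
  have "(\<lambda>k. (a k - b k) * z ^ k) sums 0" if "0 < z" "z < 1" for z
    using sums_diff[OF assms[OF that]] by (simp add: algebra_simps)
  then have "a n - b n = 0" by (rule powser_coeff_zero)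
  then show ?thesis by simp
qed

text \<open>Dominated convergence, with the absolute value of \<open>Y\<close> as bound, expands the
  integral along the level sets of \<open>N\<close>. The general weight \<phi> serves two readings:
  powers of \<open>z\<close>, giving power series, and indicators, giving probabilities.\<close>

lemma sums_integral_nat_valued:
  fixes N :: "'a \<Rightarrow> nat" and Y :: "'a \<Rightarrow> real" and \<phi> :: "nat \<Rightarrow> real"
  assumes [measurable]: "N \<in> measurable M (count_space UNIV)" "integrable M Y"
    and \<phi>: "\<And>k. \<bar>\<phi> k\<bar> \<le> 1"
  shows "(\<lambda>k. (\<integral>\<omega>. Y \<omega> * indicator {\<omega>. N \<omega> = k} \<omega> \<partial>M) * \<phi> k) sums (\<integral>\<omega>. Y \<omega> * \<phi> (N \<omega>) \<partial>M)"
proof -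
  have int: "integrable M (\<lambda>\<omega>. Y \<omega> * indicator {\<omega>. N \<omega> = k} \<omega>)" for k
    by (rule Bochner_Integration.integrable_bound[OF assms(2)]) (auto simp: indicator_def)
  have s: "(\<Sum>k<n. Y \<omega> * indicator {\<omega>. N \<omega> = k} \<omega> * \<phi> k) = (if N \<omega> < n then Y \<omega> * \<phi> (N \<omega>) else 0)"
    for n \<omega>
  proof -
    have "(\<Sum>k<n. Y \<omega> * indicator {\<omega>. N \<omega> = k} \<omega> * \<phi> k)
        = (\<Sum>k<n. if k = N \<omega> then Y \<omega> * \<phi> (N \<omega>) else 0)"
      by (intro sum.cong) (auto simp: indicator_def)
    then show ?thesis by (simp add: sum.delta)
  qed
  have "(\<lambda>n. \<integral>\<omega>. (if N \<omega> < n then Y \<omega> * \<phi> (N \<omega>) else 0) \<partial>M) \<longlonglongrightarrow> (\<integral>\<omega>. Y \<omega> * \<phi> (N \<omega>) \<partial>M)"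
  proof (rule integral_dominated_convergence[where w="\<lambda>\<omega>. \<bar>Y \<omega>\<bar>"])
    show "AE x in M. (\<lambda>i. if N x < i then Y x * \<phi> (N x) else 0) \<longlonglongrightarrow> Y x * \<phi> (N x)"
      by (intro AE_I2 tendsto_eventually eventually_mono[OF eventually_gt_at_top]) auto
    show "AE x in M. norm (if N x < i then Y x * \<phi> (N x) else 0) \<le> \<bar>Y x\<bar>" for i
      using \<phi> by (auto simp: abs_mult mult_left_le)
  qed (use assms in auto)
  then show ?thesis
    unfolding s[symmetric] sums_def
    by (subst (asm) Bochner_Integration.integral_sum) (use int in auto)
qed

context prob_space
begin

text \<open>Both sides of \<open>eq\<close> are power series in \<open>z\<close> whose coefficients
  are expectations over \<open>N = k\<close>. Comparing coefficients and summing them again with the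
  weight \<open>indicator A\<close> trades the power for the indicator.\<close>

lemma expectation_nat_valued_pgf_eqI:
  fixes N :: "'a \<Rightarrow> nat" and Y :: "'a \<Rightarrow> real"
  assumes [measurable]: "N \<in> measurable M (count_space UNIV)" "integrable M Y"
    and eq: "\<And>z. z \<in> {0..1} \<Longrightarrow> expectation (\<lambda>\<omega>. Y \<omega> * z ^ N \<omega>) = c * expectation (\<lambda>\<omega>. z ^ N \<omega>)"
  shows "expectation (\<lambda>\<omega>. Y \<omega> * indicator A (N \<omega>)) = c * expectation (\<lambda>\<omega>. indicator A (N \<omega>))"
proof -
  have E: "expectation (\<lambda>\<omega>. Y \<omega> * indicator {\<omega>. N \<omega> = k} \<omega>)
      = expectation (\<lambda>\<omega>. c * indicator {\<omega>. N \<omega> = k} \<omega>)" for k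
  proof (rule powser_coeff_eqI)
    fix z :: real assume z: "0 < z" "z < 1"
    show "(\<lambda>k. expectation (\<lambda>\<omega>. Y \<omega> * indicator {\<omega>. N \<omega> = k} \<omega>) * z ^ k)
        sums expectation (\<lambda>\<omega>. Y \<omega> * z ^ N \<omega>)"
      by (rule sums_integral_nat_valued) (use z assms in \<open>auto simp: power_le_one\<close>)
    have "(\<lambda>k. expectation (\<lambda>\<omega>. c * indicator {\<omega>. N \<omega> = k} \<omega>) * z ^ k)
        sums expectation (\<lambda>\<omega>. c * z ^ N \<omega>)"
      by (rule sums_integral_nat_valued) (use z in \<open>auto simp: power_le_one\<close>)
    then show "(\<lambda>k. expectation (\<lambda>\<omega>. c * indicator {\<omega>. N \<omega> = k} \<omega>) * z ^ k)
        sums expectation (\<lambda>\<omega>. Y \<omega> * z ^ N \<omega>)"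
      using eq[of z] z by simp
  qed
  have "(\<lambda>k. expectation (\<lambda>\<omega>. Y \<omega> * indicator {\<omega>. N \<omega> = k} \<omega>) * indicator A k)
      sums expectation (\<lambda>\<omega>. Y \<omega> * indicator A (N \<omega>))"
    by (rule sums_integral_nat_valued) (use assms in \<open>auto simp: indicator_def\<close>)
  moreover have "(\<lambda>k. expectation (\<lambda>\<omega>. c * indicator {\<omega>. N \<omega> = k} \<omega>) * indicator A k)
      sums expectation (\<lambda>\<omega>. c * indicator A (N \<omega>))"
    by (rule sums_integral_nat_valued) (auto simp: indicator_def)
  ultimately have "expectation (\<lambda>\<omega>. Y \<omega> * indicator A (N \<omega>)) = expectation (\<lambda>\<omega>. c * indicator A (N \<omega>))"
    unfolding E by (rule sums_unique2)
  then show ?thesis by simp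
qed

text \<open>In \<open>mixed\<close> the variables in \<open>D\<close> already carry indicators and
  the others still carry powers: \<open>D = {}\<close> is the hypothesis, and \<open>D = I\<close>
  is the product formula for probabilities.\<close>

lemma indep_vars_nat_pgfI:
  fixes N :: "'i \<Rightarrow> 'a \<Rightarrow> nat"
  assumes I: "finite I"
    and N[measurable]: "\<And>i. i \<in> I \<Longrightarrow> N i \<in> measurable M (count_space UNIV)"
    and pgf: "\<And>z :: 'i \<Rightarrow> real. (\<And>i. i \<in> I \<Longrightarrow> z i \<in> {0..1}) \<Longrightarrow>
      expectation (\<lambda>\<omega>. \<Prod>i\<in>I. z i ^ N i \<omega>) = (\<Prod>i\<in>I. expectation (\<lambda>\<omega>. z i ^ N i \<omega>))"
  shows "indep_vars (\<lambda>_. count_space UNIV) N I"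
\<comment> \<open>The characterisation used below needs a nonempty index set: an empty intersection
  would be \<open>UNIV\<close> instead of \<open>space M\<close>.\<close>
proof (cases "I = {}")
  case True
  then show ?thesis by (simp add: indep_vars_def2 indep_sets_def)
next
  case False
  \<comment> \<open>Powers are traded for indicators one variable at a time, by uniqueness of power series in that variable.\<close>
  have mixed: "expectation (\<lambda>\<omega>. (\<Prod>i\<in>D. indicator (A i) (N i \<omega>)) * (\<Prod>i\<in>I - D. z i ^ N i \<omega>))
      = (\<Prod>i\<in>D. expectation (\<lambda>\<omega>. indicator (A i) (N i \<omega>))) * (\<Prod>i\<in>I - D. expectation (\<lambda>\<omega>. z i ^ N i \<omega>))"
    if "finite D" "D \<subseteq> I" "\<And>i. i \<in> I \<Longrightarrow> z i \<in> {0..1}" for D and z :: "'i \<Rightarrow> real" and A :: "'i \<Rightarrow> nat set"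
    using that
  proof (induction D arbitrary: z)
    case empty
    then show ?case using pgf[of z] by (simp add: empty.prems)
  next
    case (insert j D)
    have j: "j \<in> I" "j \<notin> D" using insert by auto
    have ID: "I - D = insert j (I - insert j D)" using j by auto
    have fin: "finite (I - insert j D)" using I by auto
    have [measurable]: "N i \<in> measurable M (count_space UNIV)" if "i \<in> insert j D" for i
      using that insert.prems N by auto
    have [measurable]: "N i \<in> measurable M (count_space UNIV)" if "i \<in> I - insert j D" for i
      using that N by auto
    have [measurable]: "N j \<in> measurable M (count_space UNIV)" using j N by auto
    define Y where "Y \<omega> = (\<Prod>i\<in>D. indicator (A i) (N i \<omega>)) * (\<Prod>i\<in>I - insert j D. z i ^ N i \<omega>)" for \<omega>
    define c where "c = (\<Prod>i\<in>D. expectation (\<lambda>\<omega>. indicator (A i) (N i \<omega>))) *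
      (\<Prod>i\<in>I - insert j D. expectation (\<lambda>\<omega>. z i ^ N i \<omega>))"
    have Ym: "Y \<in> borel_measurable M"
      unfolding Y_def by measurable
    have "0 \<le> Y \<omega> \<and> Y \<omega> \<le> 1" for \<omega>
      unfolding Y_def using insert.prems(2)
      by (intro conjI mult_nonneg_nonneg mult_le_one prod_nonneg prod_le_1)
        (auto simp: indicator_def power_le_one)
    then have Y: "integrable M Y"
      by (intro integrable_const_bound[where B=1] Ym) auto
    have "expectation (\<lambda>\<omega>. Y \<omega> * indicator (A j) (N j \<omega>)) = c * expectation (\<lambda>\<omega>. indicator (A j) (N j \<omega>))"
    proof (rule expectation_nat_valued_pgf_eqI)
      fix w :: real assume w: "w \<in> {0..1}"
      \<comment> \<open>Varying \<open>z j\<close> alone leaves \<open>Y\<close> and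
        \<open>c\<close> fixed, since \<open>j\<close> is missing from all of their
        products.\<close>
      have "expectation (\<lambda>\<omega>. (\<Prod>i\<in>D. indicator (A i) (N i \<omega>)) * (\<Prod>i\<in>I - D. (z(j := w)) i ^ N i \<omega>))
        = (\<Prod>i\<in>D. expectation (\<lambda>\<omega>. indicator (A i) (N i \<omega>))) *
          (\<Prod>i\<in>I - D. expectation (\<lambda>\<omega>. (z(j := w)) i ^ N i \<omega>))"
        using insert.prems w by (intro insert.IH) auto
      moreover have "(\<Prod>i\<in>I - insert j D. (z(j := w)) i ^ N i \<omega>) = (\<Prod>i\<in>I - insert j D. z i ^ N i \<omega>)" for \<omega>
        by (intro prod.cong) auto
      moreover have "(\<Prod>i\<in>I - insert j D. expectation (\<lambda>\<omega>. (z(j := w)) i ^ N i \<omega>))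
          = (\<Prod>i\<in>I - insert j D. expectation (\<lambda>\<omega>. z i ^ N i \<omega>))"
        by (intro prod.cong) auto
      ultimately show "expectation (\<lambda>\<omega>. Y \<omega> * w ^ N j \<omega>) = c * expectation (\<lambda>\<omega>. w ^ N j \<omega>)"
        unfolding ID prod.insert[OF fin, of j, simplified] Y_def c_def
        by (simp add: mult_ac)
    qed (use Y in auto)
    moreover have Y_eq: "(\<Prod>i\<in>insert j D. indicator (A i) (N i \<omega>)) * (\<Prod>i\<in>I - insert j D. z i ^ N i \<omega>)
        = Y \<omega> * indicator (A j) (N j \<omega>)" for \<omega>
      using insert.hyps by (simp add: Y_def mult_ac)
    ultimately show ?case
      unfolding Y_eq using insert.hyps by (simp add: c_def mult_ac)
  qed
  have E: "expectation (\<lambda>\<omega>. indicat_real A (N i \<omega>)) = prob (N i -` A \<inter> space M)" if "i \<in> I" for i A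
  proof -
    have "expectation (\<lambda>\<omega>. indicat_real A (N i \<omega>)) = expectation (indicator (N i -` A \<inter> space M))"
      by (intro Bochner_Integration.integral_cong) (auto simp: indicator_def)
    then show ?thesis using measurable_sets[OF N[OF that], of A] by simp
  qed
  have factor: "\<forall>A\<in>(\<Pi> i\<in>I. UNIV). prob (\<Inter>j\<in>I. N j -` A j \<inter> space M) = (\<Prod>j\<in>I. prob (N j -` A j \<inter> space M))"
  proof
      fix A :: "'i \<Rightarrow> nat set"
      have "expectation (\<lambda>\<omega>. \<Prod>i\<in>I. indicator (A i) (N i \<omega>)) = (\<Prod>i\<in>I. prob (N i -` A i \<inter> space M))"
        using mixed[OF I order.refl, of "\<lambda>_. 1" A] by (simp add: E)
      moreover have "expectation (\<lambda>\<omega>. \<Prod>i\<in>I. indicat_real (A i) (N i \<omega>))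
          = expectation (indicator (\<Inter>j\<in>I. N j -` A j \<inter> space M))"
      proof (intro Bochner_Integration.integral_cong refl)
        fix \<omega> assume "\<omega> \<in> space M"
        then show "(\<Prod>i\<in>I. indicat_real (A i) (N i \<omega>)) = indicator (\<Inter>j\<in>I. N j -` A j \<inter> space M) \<omega>"
          by (cases "\<forall>i\<in>I. N i \<omega> \<in> A i") (auto simp: prod_zero_iff[OF I] indicator_def)
      qed
      moreover have "(\<Inter>j\<in>I. N j -` A j \<inter> space M) \<in> events"
        using I False by (intro sets.finite_INT measurable_sets[OF N]) auto
      ultimately show "prob (\<Inter>j\<in>I. N j -` A j \<inter> space M) = (\<Prod>j\<in>I. prob (N j -` A j \<inter> space M))"
        by simp
  qed
  have "sigma_sets UNIV UNIV = (UNIV :: nat set set)"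
    by (auto intro: sigma_sets.Basic)
  then have "indep_vars (\<lambda>_. count_space UNIV) N I \<longleftrightarrow>
      (\<forall>A\<in>(\<Pi> i\<in>I. UNIV). prob (\<Inter>j\<in>I. N j -` A j \<inter> space M) = (\<Prod>j\<in>I. prob (N j -` A j \<inter> space M)))"
    by (intro indep_vars_finite[OF False I]) (auto intro: N simp: Int_stable_def)
  then show ?thesis using factor by (rule iffD2)
qed

section \<open>Generating function and mean of a Poisson variable\<close>

lemma poisson_pgf_sums:
  fixes m z :: real
  shows "(\<lambda>k. (m ^ k / fact k * exp (- m)) * z ^ k) sums exp (- (1 - z) * m)"
proof -
  have "(\<lambda>k. exp (- m) * ((m * z) ^ k /\<^sub>R fact k)) sums (exp (- m) * exp (m * z))"
    by (intro sums_mult exp_converges)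
  then show ?thesis
    by (simp add: power_mult_distrib field_simps exp_add[symmetric])
qed

lemma pgf_sums:
  fixes N :: "'a \<Rightarrow> nat"
  assumes "N \<in> measurable M (count_space UNIV)" "z \<in> {0..1}"
  shows "(\<lambda>k. prob {\<omega> \<in> space M. N \<omega> = k} * z ^ k) sums expectation (\<lambda>\<omega>. z ^ N \<omega>)"
proof -
  have "{\<omega>. N \<omega> = k} \<inter> space M = {\<omega> \<in> space M. N \<omega> = k}" for k by auto
  then show ?thesis
    using sums_integral_nat_valued[OF assms(1), of "\<lambda>_. 1" "\<lambda>k. z ^ k"] assms(2)
    by (simp add: power_le_one)
qed

lemma poisson_distributed_pgf:
  assumes "poisson_distributed M N m" "z \<in> {0..1}"
  shows "expectation (\<lambda>\<omega>. z ^ N \<omega>) = exp (- (1 - z) * m)"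
proof -
  have "(\<lambda>k. (m ^ k / fact k * exp (- m)) * z ^ k) sums expectation (\<lambda>\<omega>. z ^ N \<omega>)"
    using pgf_sums[of N z] assms by (simp add: poisson_distributed_def)
  then show ?thesis using poisson_pgf_sums[of m z] by (rule sums_unique2)
qed

lemma poisson_distributed_pgfI:
  assumes "N \<in> measurable M (count_space UNIV)" "0 \<le> m"
    and "\<And>z. z \<in> {0..1} \<Longrightarrow> expectation (\<lambda>\<omega>. z ^ N \<omega>) = exp (- (1 - z) * m)"
  shows "poisson_distributed M N m"
proof -
  have "prob {\<omega> \<in> space M. N \<omega> = k} = m ^ k / fact k * exp (- m)" for k
  proof (rule powser_coeff_eqI)
    fix z :: real assume "0 < z" "z < 1"
    then show "(\<lambda>k. prob {\<omega> \<in> space M. N \<omega> = k} * z ^ k) sums exp (- (1 - z) * m)"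
      using pgf_sums[OF assms(1), of z] assms(3)[of z] by simp
  qed (rule poisson_pgf_sums)
  then show ?thesis using assms by (simp add: poisson_distributed_def)
qed

text \<open>The form as a nonnegative integral is the one in which the intensity measure of the
  arrivals is computed below.\<close>

lemma poisson_distributed_mean:
  assumes "poisson_distributed M N m"
  shows "(\<integral>\<^sup>+\<omega>. of_nat (N \<omega>) \<partial>M) = ennreal m"
proof -
  have [measurable]: "N \<in> measurable M (count_space UNIV)" and "0 \<le> m"
    and p: "prob {\<omega> \<in> space M. N \<omega> = k} = m ^ k / fact k * exp (- m)" for k
    using assms by (auto simp: poisson_distributed_def)
  have "(\<integral>\<^sup>+\<omega>. of_nat (N \<omega>) \<partial>M) = (\<integral>\<^sup>+\<omega>. (\<Sum>k. of_nat k * indicator {\<omega> \<in> space M. N \<omega> = k} \<omega>) \<partial>M)"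
  proof (intro nn_integral_cong)
    fix \<omega> assume "\<omega> \<in> space M"
    then have "(\<Sum>k. of_nat k * indicator {\<omega> \<in> space M. N \<omega> = k} \<omega> :: ennreal)
        = (\<Sum>k\<in>{N \<omega>}. of_nat k * indicator {\<omega> \<in> space M. N \<omega> = k} \<omega>)"
      by (intro suminf_finite) auto
    then show "of_nat (N \<omega>) = (\<Sum>k. of_nat k * indicator {\<omega> \<in> space M. N \<omega> = k} \<omega> :: ennreal)"
      using \<open>\<omega> \<in> space M\<close> by simp
  qed
  also have "\<dots> = (\<Sum>k. of_nat k * emeasure M {\<omega> \<in> space M. N \<omega> = k})"
    by (subst nn_integral_suminf) (auto simp: nn_integral_cmult)
  also have "\<dots> = (\<Sum>k. ennreal (k * (m ^ k / fact k * exp (- m))))"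
    by (intro suminf_cong)
      (use \<open>0 \<le> m\<close> in \<open>simp add: emeasure_eq_measure p ennreal_of_nat_eq_real_of_nat ennreal_mult[symmetric]\<close>)
  also have "\<dots> = ennreal m"
  proof (rule suminf_ennreal_eq)
    \<comment> \<open>At \<open>z = 1\<close> the generating series is the total mass 1. The term of
      the mean at \<open>Suc k\<close> is \<open>m\<close> times the probability of
      \<open>k\<close>, and the term at 0 vanishes, so the mean is \<open>m\<close> times the total
      mass.\<close>
    have "(\<lambda>k. m * ((m ^ k / fact k * exp (- m)) * 1 ^ k)) sums (m * exp (- (1 - 1) * m))"
      by (intro sums_mult poisson_pgf_sums)
    moreover have "real (Suc k) * (m ^ Suc k / fact (Suc k) * exp (- m)) = m * (m ^ k / fact k * exp (- m) * 1 ^ k)" for k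
      by (simp add: field_simps del: of_nat_Suc)
    ultimately have "(\<lambda>k. real (Suc k) * (m ^ Suc k / fact (Suc k) * exp (- m))) sums (m * exp (- (1 - 1) * m))"
      by (simp only:)
    then show "(\<lambda>k. real k * (m ^ k / fact k * exp (- m))) sums m"
      by (subst (asm) sums_Suc_iff) simp
  qed (use \<open>0 \<le> m\<close> in auto)
  finally show ?thesis .
qed

end

section \<open>The generating functional of a Poisson process\<close>

lemma measurable_point_count [measurable]:
  assumes [measurable]: "K \<in> measurable M (count_space UNIV)" "\<And>i. X i \<in> borel_measurable M" "J \<in> sets borel"
  shows "point_count K X J \<in> measurable M (count_space UNIV)"
proof -
  have "point_count K X J = (\<lambda>\<omega>. \<Sum>i<K \<omega>. if X i \<omega> \<in> J then 1 else 0)"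
  proof
    fix \<omega>
    have "{i. i < K \<omega> \<and> X i \<omega> \<in> J} = {i \<in> {..<K \<omega>}. X i \<omega> \<in> J}" by auto
    then show "point_count K X J \<omega> = (\<Sum>i<K \<omega>. if X i \<omega> \<in> J then 1 else 0)"
      unfolding point_count_def by (simp add: sum.If_cases Int_def)
  qed
  moreover have "(\<lambda>\<omega>. \<Sum>i<K \<omega>. if X i \<omega> \<in> J then 1 else 0 :: nat) \<in> measurable M (count_space UNIV)"
    by (rule measurable_compose_countable[where g=K]) measurable
  ultimately show ?thesis by simp
qed

lemma measurable_prod_points [measurable]:
  fixes K :: "'a \<Rightarrow> nat" and f :: "real \<Rightarrow> 'b::{second_countable_topology, real_normed_field}"
  assumes [measurable]: "K \<in> measurable M (count_space UNIV)" "\<And>i. X i \<in> borel_measurable M" "f \<in> borel_measurable borel"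
  shows "(\<lambda>\<omega>. \<Prod>i<K \<omega>. f (X i \<omega>)) \<in> borel_measurable M"
  by (rule measurable_compose_countable[where g=K]) measurable

section \<open>Step weights and joint generating functions of counts\<close>

text \<open>Takes the value \<open>z j\<close> on \<open>A j\<close> when the sets \<open>A j\<close>, \<open>j \<in> I\<close>, are disjoint, and \<open>1\<close> elsewhere.\<close>

definition step_weight :: "'i set \<Rightarrow> ('i \<Rightarrow> real set) \<Rightarrow> ('i \<Rightarrow> real) \<Rightarrow> real \<Rightarrow> real" where
  "step_weight I A z x = (\<Prod>j\<in>I. if x \<in> A j then z j else 1)"

lemma measurable_step_weight [measurable]:
  assumes [measurable]: "\<And>j. j \<in> I \<Longrightarrow> A j \<in> sets borel"
  shows "step_weight I A z \<in> borel_measurable borel"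
  unfolding step_weight_def by measurable

lemma step_weight_mem:
  assumes "\<And>j. j \<in> I \<Longrightarrow> z j \<in> {0..1}"
  shows "step_weight I A z x \<in> {0..1}"
  unfolding step_weight_def using assms by (auto intro!: prod_nonneg prod_le_1)

lemma step_weight_eq:
  assumes "finite I" "disjoint_family_on A I" "j \<in> I" "x \<in> A j"
  shows "step_weight I A z x = z j"
proof -
  have "step_weight I A z x = (if x \<in> A j then z j else 1) * (\<Prod>k\<in>I - {j}. if x \<in> A k then z k else 1)"
    unfolding step_weight_def by (rule prod.remove) (use assms in auto)
  also have "(\<Prod>k\<in>I - {j}. if x \<in> A k then z k else 1) = (\<Prod>k\<in>I - {j}. 1)"
    using assms by (intro prod.cong) (auto simp: disjoint_family_on_def)
  finally show ?thesis using assms by simp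
qed

text \<open>At most one \<open>A j\<close> contains \<open>x\<close>, so the product has at most one
  factor different from 1 and becomes affine in the \<open>z j\<close>. This is what later splits
  the exponent into a sum over \<open>j\<close>.\<close>

lemma one_minus_step_weight:
  assumes "finite I" "disjoint_family_on A I"
  shows "1 - step_weight I A z x = (\<Sum>j\<in>I. (1 - z j) * indicator (A j) x)"
proof (cases "\<exists>j\<in>I. x \<in> A j")
  case True
  then obtain j where j: "j \<in> I" "x \<in> A j" by auto
  have "(\<Sum>k\<in>I. (1 - z k) * indicator (A k) x)
      = (1 - z j) * indicator (A j) x + (\<Sum>k\<in>I - {j}. (1 - z k) * indicator (A k) x)"
    by (rule sum.remove) (use assms j in auto)
  also have "(\<Sum>k\<in>I - {j}. (1 - z k) * indicator (A k) x) = (\<Sum>k\<in>I - {j}. 0)"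
  proof (intro sum.cong refl)
    fix k assume "k \<in> I - {j}"
    then have "x \<notin> A k" using assms(2) j by (auto simp: disjoint_family_on_def)
    then show "(1 - z k) * indicator (A k) x = 0" by simp
  qed
  finally show ?thesis using step_weight_eq[OF assms j] j by simp
next
  case False
  then show ?thesis by (auto simp: step_weight_def)
qed

text \<open>Exchanging the products, each point in \<open>A j\<close> contributes one factor
  \<open>z j\<close>. The identity is applied to arrivals and to bids alike.\<close>

lemma prod_points_step_weight:
  assumes "finite I"
  shows "(\<Prod>i<K \<omega>. step_weight I A z (X i \<omega>)) = (\<Prod>j\<in>I. z j ^ point_count K X (A j) \<omega>)"
proof -
  have "(\<Prod>i<K \<omega>. if X i \<omega> \<in> A j then z j else 1) = z j ^ point_count K X (A j) \<omega>" for j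
  proof -
    have "{..<K \<omega>} \<inter> {i. X i \<omega> \<in> A j} = {i. i < K \<omega> \<and> X i \<omega> \<in> A j}" by auto
    then show ?thesis by (simp add: prod.If_cases point_count_def)
  qed
  then show ?thesis
    unfolding step_weight_def by (subst prod.swap) simp
qed

locale poisson_arrivals = prob_space M for M :: "'a measure" +
  fixes T lam :: real and K :: "'a \<Rightarrow> nat" and S :: "nat \<Rightarrow> 'a \<Rightarrow> real"
  assumes T: "0 < T" and lam: "0 < lam"
    and K [measurable]: "K \<in> measurable M (count_space UNIV)"
    and S [measurable]: "\<And>i. S i \<in> borel_measurable M"
    and S_range: "\<And>i \<omega>. \<omega> \<in> space M \<Longrightarrow> i < K \<omega> \<Longrightarrow> S i \<omega> \<in> {0..T}"
    and poisson: "poisson_process M T (\<lambda>_. lam) (point_count K S)"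
begin

lemma poisson_count:
  assumes "0 \<le> u" "u \<le> v" "v \<le> T"
  shows "poisson_distributed M (point_count K S {u<..v}) (lam * (v - u))"
proof -
  have "(LINT t:{u..v}|lborel. lam) = lam * (v - u)"
    using assms by (simp add: set_lebesgue_integral_def)
  moreover have "poisson_distributed M (point_count K S {u<..v}) (LINT t:{u..v}|lborel. lam)"
    using poisson assms by (simp add: poisson_process_def)
  ultimately show ?thesis by simp
qed

text \<open>Since the intervals \<open>{u<..v}\<close> never contain 0, an arrival at 0 is excluded
  through the conjunct of \<open>poisson_process\<close> on \<open>N {0}\<close>.\<close>

lemma AE_arrival_pos: "AE \<omega> in M. \<forall>i<K \<omega>. S i \<omega> \<in> {0<..T}"
proof -
  have "AE \<omega> in M. point_count K S {0} \<omega> = 0"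
    using poisson by (simp add: poisson_process_def)
  then show ?thesis
    using AE_space
  proof eventually_elim
    case (elim \<omega>)
    then have "S i \<omega> \<noteq> 0" if "i < K \<omega>" for i
      using that by (auto simp: point_count_def)
    then show ?case using S_range[OF elim(2)] by (auto simp: less_le)
  qed
qed

text \<open>The mean measure of the arrivals: counting measure times \<open>M\<close>, restricted to
  the pairs with \<open>i < K \<omega>\<close> and mapped to the line by \<open>S\<close>. In this
  form it is a measure by construction.\<close>

definition intensity_measure :: "real measure" where
  "intensity_measure = distr (density (count_space UNIV \<Otimes>\<^sub>M M) (\<lambda>(i, \<omega>). indicator {\<omega>. i < K \<omega>} \<omega>)) borel (\<lambda>(i, \<omega>). S i \<omega>)"

lemma emeasure_intensity_measure:
  assumes [measurable]: "A \<in> sets borel"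
  shows "emeasure intensity_measure A = (\<integral>\<^sup>+\<omega>. of_nat (point_count K S A \<omega>) \<partial>M)"
proof -
  interpret P: pair_sigma_finite "count_space (UNIV :: nat set)" M
    by (intro pair_sigma_finite.intro sigma_finite_measure_count_space sigma_finite_measure_axioms)
  have [measurable]: "(\<lambda>(i, \<omega>). S i \<omega>) \<in> borel_measurable (count_space UNIV \<Otimes>\<^sub>M M)"
    by (rule measurable_pair_measure_countable1) auto
  have [measurable]: "(\<lambda>(i, \<omega>). indicator {\<omega>. i < K \<omega>} \<omega> :: ennreal) \<in> borel_measurable (count_space UNIV \<Otimes>\<^sub>M M)"
    by (rule measurable_pair_measure_countable1) auto
  have "emeasure intensity_measure A = (\<integral>\<^sup>+x. indicator A x \<partial>intensity_measure)"
    by (simp add: intensity_measure_def)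
  also have "\<dots> = (\<integral>\<^sup>+(i, \<omega>). indicator {\<omega>. i < K \<omega>} \<omega> * indicator A (S i \<omega>) \<partial>(count_space UNIV \<Otimes>\<^sub>M M))"
    unfolding intensity_measure_def
    by (subst nn_integral_distr, measurable, subst nn_integral_density) (auto simp: case_prod_beta')
  also have "\<dots> = (\<integral>\<^sup>+\<omega>. (\<integral>\<^sup>+i. indicator {\<omega>. i < K \<omega>} \<omega> * indicator A (S i \<omega>) \<partial>count_space UNIV) \<partial>M)"
    by (subst P.nn_integral_snd[symmetric]) (auto simp: case_prod_beta')
  also have "\<dots> = (\<integral>\<^sup>+\<omega>. of_nat (point_count K S A \<omega>) \<partial>M)"
  proof (intro nn_integral_cong)
    fix \<omega>
    have "(\<integral>\<^sup>+i. indicator {\<omega>. i < K \<omega>} \<omega> * indicator A (S i \<omega>) \<partial>count_space UNIV)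
       = (\<integral>\<^sup>+i. indicator {i. i < K \<omega> \<and> S i \<omega> \<in> A} i \<partial>count_space UNIV)"
      by (intro nn_integral_cong) (auto simp: indicator_def)
    also have "\<dots> = of_nat (point_count K S A \<omega>)"
      by (simp add: emeasure_count_space point_count_def)
    finally show "(\<integral>\<^sup>+i. indicator {\<omega>. i < K \<omega>} \<omega> * indicator A (S i \<omega>) \<partial>count_space UNIV)
      = of_nat (point_count K S A \<omega>)" .
  qed
  finally show ?thesis .
qed

text \<open>Two Borel measures that are finite on the rays \<open>{x<..}\<close> and agree there
  coincide. On a ray the arrivals almost surely lie in some \<open>{u<..T}\<close>, whose count has
  a known Poisson mean.\<close>

lemma intensity_measure_eq:
  "intensity_measure = density lborel (\<lambda>s. ennreal lam * indicator {0<..T} s)"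
proof (rule measure_eqI_lessThan)
  have A: "emeasure intensity_measure {x<..} = ennreal lam * emeasure lborel ({x<..} \<inter> {0<..T})" for x
  proof -
    \<comment> \<open>This is \<open>x\<close> clamped to [0, T], so that rays starting below 0 or
      beyond \<open>T\<close> need no separate treatment.\<close>
    define u where "u = max 0 (min x T)"
    have u: "0 \<le> u" "u \<le> T" using T by (auto simp: u_def)
    have "emeasure intensity_measure {x<..} = (\<integral>\<^sup>+\<omega>. of_nat (point_count K S {x<..} \<omega>) \<partial>M)"
      by (rule emeasure_intensity_measure) simp
    also have "\<dots> = (\<integral>\<^sup>+\<omega>. of_nat (point_count K S {u<..T} \<omega>) \<partial>M)"
    proof (rule nn_integral_cong_AE)
      show "AE \<omega> in M. of_nat (point_count K S {x<..} \<omega>) = (of_nat (point_count K S {u<..T} \<omega>) :: ennreal)"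
        using AE_arrival_pos
      proof eventually_elim
        case (elim \<omega>)
        then have "{i. i < K \<omega> \<and> S i \<omega> \<in> {x<..}} = {i. i < K \<omega> \<and> S i \<omega> \<in> {u<..T}}"
          by (auto simp: u_def)
        then show ?case by (simp add: point_count_def)
      qed
    qed
    also have "\<dots> = ennreal (lam * (T - u))"
      using poisson_distributed_mean[OF poisson_count[OF u(1) u(2) order.refl]] .
    also have "\<dots> = ennreal lam * emeasure lborel {u<..T}"
      using lam u by (simp add: ennreal_mult)
    also have "{u<..T} = {x<..} \<inter> {0<..T}" using T by (auto simp: u_def)
    finally show ?thesis .
  qed
  have B: "emeasure (density lborel (\<lambda>s. ennreal lam * indicator {0<..T} s)) {x<..}
     = ennreal lam * emeasure lborel ({x<..} \<inter> {0<..T})" for x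
    by (simp add: emeasure_density nn_integral_cmult mult.assoc indicator_inter_arith[symmetric] Int_commute)
  show "emeasure intensity_measure {x<..} = emeasure (density lborel (\<lambda>s. ennreal lam * indicator {0<..T} s)) {x<..}" for x
    unfolding A B ..
  show "emeasure intensity_measure {x<..} < \<infinity>" for x
  proof -
    have "emeasure lborel ({x<..} \<inter> {0<..T}) \<le> emeasure lborel {0<..T}"
      by (intro emeasure_mono) auto
    also have "\<dots> < \<infinity>" using T by simp
    finally show ?thesis unfolding A by (simp add: ennreal_mult_less_top)
  qed
qed (auto simp: intensity_measure_def)

text \<open>The expected number of arrivals in \<open>N\<close> is the intensity of
  \<open>N\<close>, which is 0, and a count with mean 0 vanishes almost surely. Thus a statement
  about Lebesgue almost every \<open>s\<close> holds almost surely at all arrivals at once.\<close>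

lemma AE_arrival_notin_null_set:
  assumes N: "N \<in> null_sets lborel"
  shows "AE \<omega> in M. \<forall>i<K \<omega>. S i \<omega> \<notin> N"
proof -
  have N' [measurable]: "N \<in> sets borel" using N by auto
  have "emeasure intensity_measure N = (\<integral>\<^sup>+s. ennreal lam * indicator {0<..T} s * indicator N s \<partial>lborel)"
    unfolding intensity_measure_eq by (rule emeasure_density) auto
  also have "\<dots> = (\<integral>\<^sup>+(s::real). 0 \<partial>lborel)"
  proof (rule nn_integral_cong_AE)
    show "AE s in lborel. ennreal lam * indicator {0<..T} s * indicator N s = 0"
      using AE_not_in[OF N] by eventually_elim simp
  qed
  finally have "emeasure intensity_measure N = 0" by simp
  then have "(\<integral>\<^sup>+\<omega>. of_nat (point_count K S N \<omega>) \<partial>M) = 0"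
    by (simp add: emeasure_intensity_measure)
  then have "AE \<omega> in M. of_nat (point_count K S N \<omega>) = (0 :: ennreal)"
    by (subst (asm) nn_integral_0_iff_AE) auto
  then show ?thesis
    by eventually_elim (auto simp: point_count_def)
qed

text \<open>The equation is the probability generating functional of a Poisson process of rate
  \<open>lam\<close>, evaluated at a single \<open>f\<close>. Measurability and range are part of
  the property because they supply what dominated convergence asks of an approximating
  sequence.\<close>

definition has_poisson_functional :: "(real \<Rightarrow> real) \<Rightarrow> bool" where
  "has_poisson_functional f \<longleftrightarrow> f \<in> borel_measurable borel \<and> range f \<subseteq> {0..1} \<and>
    expectation (\<lambda>\<omega>. \<Prod>i<K \<omega>. f (S i \<omega>)) = exp (- lam * (LINT s:{0..T}|lborel. 1 - f s))"

text \<open>Dominated convergence on both sides: the products are bounded by 1, the integrands by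
  the indicator of the time interval. The exceptional times, 0 and \<open>N\<close>, are almost
  surely no arrival times, and they form a null set for the integral.\<close>

lemma has_poisson_functional_limit:
  assumes F: "\<And>n. has_poisson_functional (F n)"
    and f [measurable]: "f \<in> borel_measurable borel" and f01: "range f \<subseteq> {0..1}"
    and lim: "\<And>s. s \<in> {0<..T} - N \<Longrightarrow> (\<lambda>n. F n s) \<longlonglongrightarrow> f s"
    and N: "N \<in> null_sets lborel"
  shows "has_poisson_functional f"
proof -
  have [measurable]: "F n \<in> borel_measurable borel" for n
    using F by (auto simp: has_poisson_functional_def)
  have F01: "0 \<le> F n s" "F n s \<le> 1" for n s
    using F by (auto simp: has_poisson_functional_def image_subset_iff)
  have "(\<lambda>n. expectation (\<lambda>\<omega>. \<Prod>i<K \<omega>. F n (S i \<omega>))) \<longlonglongrightarrow> expectation (\<lambda>\<omega>. \<Prod>i<K \<omega>. f (S i \<omega>))"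
  proof (rule integral_dominated_convergence[where w="\<lambda>_. 1"])
    show "AE \<omega> in M. (\<lambda>n. \<Prod>i<K \<omega>. F n (S i \<omega>)) \<longlonglongrightarrow> (\<Prod>i<K \<omega>. f (S i \<omega>))"
      using AE_arrival_pos AE_arrival_notin_null_set[OF N]
      by eventually_elim (auto intro!: tendsto_prod lim)
    show "AE \<omega> in M. norm (\<Prod>i<K \<omega>. F n (S i \<omega>)) \<le> 1" for n
      using F01 by (auto simp: abs_prod intro!: prod_le_1)
  qed auto
  moreover have "(\<lambda>n. LINT s:{0..T}|lborel. 1 - F n s) \<longlonglongrightarrow> (LINT s:{0..T}|lborel. 1 - f s)"
    unfolding set_lebesgue_integral_def
  proof (rule integral_dominated_convergence[where w="indicator {0..T}"])
    have "{0} \<union> N \<in> null_sets lborel"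
      by (intro null_sets.Un N finite_imp_null_set_lborel) simp
    then have "insert 0 N \<in> null_sets lborel" by simp
    then have "AE s in lborel. s \<notin> insert 0 N" by (rule AE_not_in)
    then show "AE s in lborel. (\<lambda>n. indicator {0..T} s *\<^sub>R (1 - F n s)) \<longlonglongrightarrow> indicator {0..T} s *\<^sub>R (1 - f s)"
    proof eventually_elim
      case (elim s)
      then show ?case
        by (cases "s \<in> {0..T}") (auto intro!: tendsto_intros lim)
    qed
    show "AE s in lborel. norm (indicator {0..T} s *\<^sub>R (1 - F n s)) \<le> indicator {0..T} s" for n
      using F01 by (auto simp: indicator_def)
    show "integrable lborel (indicat_real {0..T})"
      using T by (intro integrable_real_indicator) auto
  qed auto
  then have "(\<lambda>n. exp (- lam * (LINT s:{0..T}|lborel. 1 - F n s))) \<longlonglongrightarrow> exp (- lam * (LINT s:{0..T}|lborel. 1 - f s))"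
    by (intro tendsto_intros)
  moreover have "expectation (\<lambda>\<omega>. \<Prod>i<K \<omega>. F n (S i \<omega>)) = exp (- lam * (LINT s:{0..T}|lborel. 1 - F n s))" for n
    using F by (simp add: has_poisson_functional_def)
  ultimately have "expectation (\<lambda>\<omega>. \<Prod>i<K \<omega>. f (S i \<omega>)) = exp (- lam * (LINT s:{0..T}|lborel. 1 - f s))"
    by (simp add: LIMSEQ_unique)
  then show ?thesis using f f01 by (simp add: has_poisson_functional_def)
qed

text \<open>Independent increments turn the expectation into a product of Poisson generating
  functions; the exponents add up to the integral of the sum in
  \<open>one_minus_step_weight\<close>.\<close>

lemma has_poisson_functional_step:
  fixes u v z :: "nat \<Rightarrow> real"
  assumes d: "disjoint_family_on (\<lambda>j. {u j<..v j}) {..<n}"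
    and uv: "\<And>j. j < n \<Longrightarrow> 0 \<le> u j \<and> u j \<le> v j \<and> v j \<le> T"
    and z: "\<And>j. j < n \<Longrightarrow> z j \<in> {0..1}"
  shows "has_poisson_functional (step_weight {..<n} (\<lambda>j. {u j<..v j}) z)"
proof -
  let ?J = "\<lambda>j. {u j<..v j}"
  let ?f = "step_weight {..<n} ?J z"
  have f01: "?f x \<in> {0..1}" for x
    by (rule step_weight_mem) (use z in auto)
  have ind: "indep_vars (\<lambda>_. count_space UNIV) (\<lambda>j. point_count K S (?J j)) {..<n}"
  proof -
    have "independent_increments M T (point_count K S)"
      using poisson by (simp add: poisson_process_def)
    moreover have "\<forall>j<n. is_interval (?J j) \<and> ?J j \<subseteq> {0..T}"
      using uv by (fastforce simp: is_interval_1)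
    ultimately show ?thesis
      using d unfolding independent_increments_def by simp
  qed
  have "expectation (\<lambda>\<omega>. \<Prod>i<K \<omega>. ?f (S i \<omega>)) = expectation (\<lambda>\<omega>. \<Prod>j<n. z j ^ point_count K S (?J j) \<omega>)"
    by (simp add: prod_points_step_weight)
  also have "\<dots> = (\<Prod>j<n. expectation (\<lambda>\<omega>. z j ^ point_count K S (?J j) \<omega>))"
  proof (rule indep_vars_lebesgue_integral)
    show "indep_vars (\<lambda>_. borel) (\<lambda>j \<omega>. z j ^ point_count K S (?J j) \<omega>) {..<n}"
      by (rule indep_vars_compose2[OF ind]) auto
    show "integrable M (\<lambda>\<omega>. z j ^ point_count K S (?J j) \<omega>)" if "j \<in> {..<n}" for j
      by (rule integrable_const_bound[where B=1]) (use z[of j] that in \<open>auto simp: power_le_one\<close>)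
  qed simp
  also have "\<dots> = (\<Prod>j<n. exp (- lam * ((1 - z j) * (v j - u j))))"
    using uv z by (intro prod.cong) (auto simp: poisson_distributed_pgf[OF poisson_count] algebra_simps)
  also have "\<dots> = exp (- lam * (\<Sum>j<n. (1 - z j) * (v j - u j)))"
    by (simp add: exp_sum sum_distrib_left)
  also have "(\<Sum>j<n. (1 - z j) * (v j - u j)) = (LINT s:{0..T}|lborel. 1 - ?f s)"
  proof -
    have "(LINT s:{0..T}|lborel. 1 - ?f s) = (LINT s|lborel. (\<Sum>j<n. (1 - z j) * indicator (?J j) s))"
      unfolding set_lebesgue_integral_def one_minus_step_weight[OF finite_lessThan d]
    proof (intro Bochner_Integration.integral_cong refl)
      fix s
      show "indicator {0..T} s *\<^sub>R (\<Sum>j<n. (1 - z j) * indicator (?J j) s) = (\<Sum>j<n. (1 - z j) * indicator (?J j) s)"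
        unfolding scaleR_sum_right using uv by (intro sum.cong) (fastforce simp: indicator_def)+
    qed
    also have "\<dots> = (\<Sum>j<n. (1 - z j) * (v j - u j))"
      by (subst Bochner_Integration.integral_sum) (use uv in \<open>auto intro!: sum.cong\<close>)
    finally show ?thesis by simp
  qed
  finally show ?thesis
    using f01 by (auto simp: has_poisson_functional_def)
qed

text \<open>A Riemann-type approximation: on each of \<open>Suc n\<close> equal cells of the time
  interval, \<open>F n\<close> takes the value of \<open>g\<close> at the right endpoint.\<close>

lemma has_poisson_functional_continuous:
  assumes g: "continuous_on UNIV g" and g01: "range g \<subseteq> {0..1}"
  shows "has_poisson_functional g"
proof -
  define u where "u n j = T * real j / Suc n" for n j
  define F where "F n = step_weight {..<Suc n} (\<lambda>j. {u n j<..u n (Suc j)}) (\<lambda>j. g (u n (Suc j)))" for n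
  have mono: "u n i \<le> u n j" if "i \<le> j" for n i j
    unfolding u_def using T that by (intro divide_right_mono mult_left_mono) auto
  have disj: "disjoint_family_on (\<lambda>j. {u n j<..u n (Suc j)}) {..<Suc n}" for n
    unfolding disjoint_family_on_def
  proof safe
    fix i j s assume "i \<noteq> j" and s: "s \<in> {u n i<..u n (Suc i)}" "s \<in> {u n j<..u n (Suc j)}"
    then have "Suc i \<le> j \<or> Suc j \<le> i" by auto
    then show "s \<in> {}" using mono[of "Suc i" j n] mono[of "Suc j" i n] s by auto
  qed
  have u0: "u n 0 = 0" and uT: "u n (Suc n) = T" for n
    by (auto simp: u_def)
  show ?thesis
  proof (rule has_poisson_functional_limit)
    show "has_poisson_functional (F n)" for n
      unfolding F_def
    proof (rule has_poisson_functional_step[OF disj])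
      show "0 \<le> u n j \<and> u n j \<le> u n (Suc j) \<and> u n (Suc j) \<le> T" if "j < Suc n" for j
        using mono[of 0 j n] mono[of j "Suc j" n] mono[of "Suc j" "Suc n" n] that by (auto simp: u0 uT)
    qed (use g01 in \<open>auto simp: image_subset_iff\<close>)
    show "(\<lambda>n. F n s) \<longlonglongrightarrow> g s" if s: "s \<in> {0<..T} - {}" for s
    proof -
      \<comment> \<open>The cells are left-open, so the ceiling picks the right endpoint of the cell
        that contains \<open>s\<close>. For \<open>s > 0\<close> it is at least 1, which makes the
        predecessor \<open>j\<close> below meaningful.\<close>
      define r where "r n = u n (nat \<lceil>s * Suc n / T\<rceil>)" for n
      have r: "F n s = g (r n)" "\<bar>r n - s\<bar> \<le> T / Suc n" for n
      proof -
        have pos: "0 < s * Suc n / T" using s T by auto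
        define j where "j = nat \<lceil>s * Suc n / T\<rceil> - 1"
        have j: "nat \<lceil>s * Suc n / T\<rceil> = Suc j" using pos by (simp add: j_def)
        then have c: "real j < s * Suc n / T" "s * Suc n / T \<le> real (Suc j)" using pos by linarith+
        have "s * Suc n \<le> T * Suc n" using s by (intro mult_right_mono) auto
        then have "s * Suc n / T \<le> Suc n" using T by (simp add: pos_divide_le_eq mult.commute)
        then have "real j < real (Suc n)" using c by linarith
        then have jn: "j < Suc n" by simp
        have sj: "s \<in> {u n j<..u n (Suc j)}"
          using c T by (auto simp: u_def field_simps)
        have "F n s = g (u n (Suc j))"
          unfolding F_def by (rule step_weight_eq[OF _ disj _ sj]) (use jn in auto)
        then show "F n s = g (r n)" unfolding r_def j .
        have "u n (Suc j) - u n j = T / Suc n"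
          unfolding u_def diff_divide_distrib[symmetric] right_diff_distrib[symmetric] by simp
        then show "\<bar>r n - s\<bar> \<le> T / Suc n" using sj unfolding r_def j by simp
      qed
      have "(\<lambda>n. T / Suc n) \<longlonglongrightarrow> 0" by (rule LIMSEQ_Suc[OF lim_const_over_n])
      then have "(\<lambda>n. r n - s) \<longlonglongrightarrow> 0"
        by (rule Lim_null_comparison[rotated]) (use r in auto)
      then have "r \<longlonglongrightarrow> s" by (simp add: LIM_zero_iff)
      moreover have "isCont g s" using g by (simp add: continuous_on_eq_continuous_at)
      ultimately show ?thesis unfolding r(1) by (rule isCont_tendsto_compose[rotated])
    qed
  qed (use g01 in \<open>auto intro: borel_measurable_continuous_onI[OF g]\<close>)
qed

lemma has_poisson_functional_borel:
  assumes f [measurable]: "f \<in> borel_measurable borel" and f01: "range f \<subseteq> {0..1}"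
  shows "has_poisson_functional f"
proof -
  have "f measurable_on UNIV"
    by (rule lebesgue_measurable_imp_measurable_on) (auto intro: measurable_completion)
  \<comment> \<open>\<open>f\<close> is a limit of continuous functions outside a null set, which the arrivals avoid almost surely.\<close>
  then obtain N g where N: "negligible N" and g: "\<And>n. continuous_on UNIV (g n)"
    and lim: "\<And>x. x \<notin> N \<Longrightarrow> (\<lambda>n. g n x) \<longlonglongrightarrow> f x"
    unfolding measurable_on_def by auto
  \<comment> \<open>\<open>N\<close> is null only for the completed measure; \<open>N'\<close> is a
    Borel null set around it, the kind that the arrivals are known to avoid.\<close>
  obtain N' where N': "N' \<in> null_sets lborel" "N \<subseteq> N'"
    using N by (auto simp: negligible_iff_null_sets null_sets_completion_iff2)
  \<comment> \<open>The continuous approximants may leave [0, 1]. Clipping them restores the range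
    and does not move the limit.\<close>
  have clip: "max 0 (min 1 (f x)) = f x" for x
    using f01 by (auto simp: image_subset_iff max_def min_def) (metis order.antisym)
  show ?thesis
  proof (rule has_poisson_functional_limit[OF _ f f01 _ N'(1)])
    show "has_poisson_functional (\<lambda>x. max 0 (min 1 (g n x)))" for n
      by (rule has_poisson_functional_continuous) (auto intro!: continuous_intros g)
    show "(\<lambda>n. max 0 (min 1 (g n s))) \<longlonglongrightarrow> f s" if "s \<in> {0<..T} - N'" for s
    proof -
      have "(\<lambda>n. max 0 (min 1 (g n s))) \<longlonglongrightarrow> max 0 (min 1 (f s))"
        using that N' by (intro tendsto_intros lim) auto
      then show ?thesis by (simp add: clip)
    qed
  qed
qed

end

section \<open>Independent marking\<close>

text \<open>Both sides integrate \<open>h\<close> against finite Borel measures: the image under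
  \<open>X\<close> of \<open>M\<close> weighted by \<open>W\<close>, and the mixture of the
  \<open>\<kappa> (Y \<omega>)\<close> weighted by \<open>W'\<close>. By \<open>eq\<close> their
  distribution functions agree, so the measures do. The weights stand for the factors of all other
  points.\<close>

lemma nn_integral_kernel_eqI:
  fixes X Y :: "'a \<Rightarrow> real" and W W' :: "'a \<Rightarrow> ennreal"
  assumes [measurable]: "X \<in> borel_measurable M" "Y \<in> borel_measurable M"
      "W \<in> borel_measurable M" "W' \<in> borel_measurable M"
    and \<kappa> [measurable]: "\<kappa> \<in> borel \<rightarrow>\<^sub>M prob_algebra borel"
    and M: "space M \<noteq> {}"
    and fin: "(\<integral>\<^sup>+\<omega>. W \<omega> \<partial>M) < \<infinity>" "(\<integral>\<^sup>+\<omega>. W' \<omega> \<partial>M) < \<infinity>"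
    and eq: "\<And>y. (\<integral>\<^sup>+\<omega>. W \<omega> * indicator {..y} (X \<omega>) \<partial>M) = (\<integral>\<^sup>+\<omega>. W' \<omega> * emeasure (\<kappa> (Y \<omega>)) {..y} \<partial>M)"
    and h [measurable]: "h \<in> borel_measurable borel"
  shows "(\<integral>\<^sup>+\<omega>. W \<omega> * h (X \<omega>) \<partial>M) = (\<integral>\<^sup>+\<omega>. W' \<omega> * (\<integral>\<^sup>+x. h x \<partial>\<kappa> (Y \<omega>)) \<partial>M)"
proof -
  define \<mu> where "\<mu> = distr (density M W) borel X"
  define \<nu> where "\<nu> = density M W' \<bind> (\<lambda>\<omega>. \<kappa> (Y \<omega>))"
  have ker: "(\<lambda>\<omega>. \<kappa> (Y \<omega>)) \<in> density M W' \<rightarrow>\<^sub>M subprob_algebra borel"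
    by (rule measurable_prob_algebraD) simp
  have ker' [measurable]: "\<kappa> \<in> borel \<rightarrow>\<^sub>M subprob_algebra borel"
    by (rule measurable_prob_algebraD) simp
  have \<mu>: "(\<integral>\<^sup>+x. k x \<partial>\<mu>) = (\<integral>\<^sup>+\<omega>. W \<omega> * k (X \<omega>) \<partial>M)" if [measurable]: "k \<in> borel_measurable borel" for k
    unfolding \<mu>_def by (simp add: nn_integral_distr nn_integral_density)
  have \<nu>: "(\<integral>\<^sup>+x. k x \<partial>\<nu>) = (\<integral>\<^sup>+\<omega>. W' \<omega> * (\<integral>\<^sup>+x. k x \<partial>\<kappa> (Y \<omega>)) \<partial>M)"
    if [measurable]: "k \<in> borel_measurable borel" for k
    unfolding \<nu>_def by (simp add: nn_integral_bind[OF that ker] nn_integral_density)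
  have sets: "sets \<mu> = sets borel" "sets \<nu> = sets borel"
    using M unfolding \<mu>_def \<nu>_def by (simp, intro sets_bind sets_kernel[OF ker]) auto
  have em: "emeasure \<mu> A = (\<integral>\<^sup>+\<omega>. W \<omega> * indicator A (X \<omega>) \<partial>M)" if A: "A \<in> sets borel" for A
    using \<mu>[of "indicator A"] A sets by simp
  have en: "emeasure \<nu> A = (\<integral>\<^sup>+\<omega>. W' \<omega> * emeasure (\<kappa> (Y \<omega>)) A \<partial>M)" if A: "A \<in> sets borel" for A
  proof -
    have "A \<in> sets (\<kappa> s)" for s using A sets_kernel[OF ker', of s] by simp
    then show ?thesis using \<nu>[of "indicator A"] A sets by simp
  qed
  have "prob_space (\<kappa> s)" "sets (\<kappa> s) = sets borel" for s
    using measurable_space[OF \<kappa>, of s] by (auto simp: space_prob_algebra)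
  then have one: "emeasure (\<kappa> s) UNIV = 1" for s
    using prob_space.emeasure_space_1[of "\<kappa> s"] sets_eq_imp_space_eq[of "\<kappa> s" borel] by simp
  have "finite_borel_measure \<mu>" "finite_borel_measure \<nu>"
    unfolding finite_borel_measure_def finite_borel_measure_axioms_def
    using sets sets_eq_imp_space_eq[OF sets(1)] sets_eq_imp_space_eq[OF sets(2)] fin
    by (auto intro!: finite_measureI simp: em en one)
  moreover have "cdf \<mu> = cdf \<nu>"
    by (auto simp: cdf_def measure_def em en eq)
  ultimately have "\<mu> = \<nu>" by (rule cdf_unique')
  then show ?thesis using \<mu>[OF h] \<nu>[OF h] by simp
qed

text \<open>The conditional independence of the marks enters in integrated form, on one event
  \<open>K = n\<close> at a time, so that all products have a fixed length and conditional
  expectations disappear from the marking argument.\<close>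

locale marked_poisson_arrivals = poisson_arrivals +
  fixes B :: "nat \<Rightarrow> 'a \<Rightarrow> real" and \<kappa> :: "real \<Rightarrow> real measure"
  assumes B [measurable]: "\<And>i. B i \<in> borel_measurable M"
    and \<kappa> [measurable]: "\<kappa> \<in> borel \<rightarrow>\<^sub>M prob_algebra borel"
    and conditional_law: "\<And>n y. (\<integral>\<^sup>+\<omega>. indicator {\<omega>. K \<omega> = n} \<omega> * (\<Prod>i<n. indicator {..y i} (B i \<omega>)) \<partial>M)
      = (\<integral>\<^sup>+\<omega>. indicator {\<omega>. K \<omega> = n} \<omega> * (\<Prod>i<n. emeasure (\<kappa> (S i \<omega>)) {..y i}) \<partial>M)"
begin

lemma prob_space_kernel: "prob_space (\<kappa> s)"
  and sets_kernel_eq [simp, measurable_cong]: "sets (\<kappa> s) = sets borel"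
  using measurable_space[OF \<kappa>, of s] by (auto simp: space_prob_algebra)

lemma space_kernel_eq [simp]: "space (\<kappa> s) = UNIV"
  using sets_eq_imp_space_eq[OF sets_kernel_eq] by simp

lemma measurable_kernel_subprob [measurable]: "\<kappa> \<in> borel \<rightarrow>\<^sub>M subprob_algebra borel"
  by (rule measurable_prob_algebraD) simp

lemma nn_integral_prod_marks_given_count:
  fixes h :: "real \<Rightarrow> ennreal"
  assumes h [measurable]: "h \<in> borel_measurable borel" and h1: "\<And>x. h x \<le> 1"
  shows "(\<integral>\<^sup>+\<omega>. indicator {\<omega>. K \<omega> = n} \<omega> * (\<Prod>i<n. h (B i \<omega>)) \<partial>M)
      = (\<integral>\<^sup>+\<omega>. indicator {\<omega>. K \<omega> = n} \<omega> * (\<Prod>i<n. \<integral>\<^sup>+x. h x \<partial>\<kappa> (S i \<omega>)) \<partial>M)"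
proof -
  define f where "f s = (\<integral>\<^sup>+x. h x \<partial>\<kappa> s)" for s
  have f [measurable]: "f \<in> borel_measurable borel"
    unfolding f_def by measurable
  have f1: "f s \<le> 1" for s
  proof -
    have "f s \<le> (\<integral>\<^sup>+x. 1 \<partial>\<kappa> s)" unfolding f_def by (intro nn_integral_mono h1)
    then show ?thesis using prob_space.emeasure_space_1[OF prob_space_kernel, of s] by simp
  qed
  have k1: "emeasure (\<kappa> s) A \<le> 1" for s A
    using prob_space.emeasure_le_1[OF prob_space_kernel] .
  have bound: "(\<integral>\<^sup>+\<omega>. W \<omega> \<partial>M) < \<infinity>" if "\<And>\<omega>. W \<omega> \<le> 1" for W :: "'a \<Rightarrow> ennreal"
  proof -
    have "(\<integral>\<^sup>+\<omega>. W \<omega> \<partial>M) \<le> (\<integral>\<^sup>+\<omega>. 1 \<partial>M)" by (intro nn_integral_mono that)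
    also have "\<dots> < \<infinity>" by (simp add: emeasure_space_1)
    finally show ?thesis .
  qed
  \<comment> \<open>The factors \<open>indicator {..y i}\<close> are replaced by \<open>h\<close> one coordinate at a time.\<close>
  have "(\<integral>\<^sup>+\<omega>. indicator {\<omega>. K \<omega> = n} \<omega> * ((\<Prod>i\<in>D. h (B i \<omega>)) * (\<Prod>i\<in>{..<n} - D. indicator {..y i} (B i \<omega>))) \<partial>M)
      = (\<integral>\<^sup>+\<omega>. indicator {\<omega>. K \<omega> = n} \<omega> * ((\<Prod>i\<in>D. f (S i \<omega>)) * (\<Prod>i\<in>{..<n} - D. emeasure (\<kappa> (S i \<omega>)) {..y i})) \<partial>M)"
    if "finite D" "D \<subseteq> {..<n}" for D y
    using that
  proof (induction D arbitrary: y)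
    case empty
    then show ?case using conditional_law[of n y] by simp
  next
    case (insert j D)
    let ?R = "{..<n} - insert j D"
    have j: "j \<notin> D" "{..<n} - D = insert j ?R" using insert by auto
    define W where "W \<omega> = indicator {\<omega>. K \<omega> = n} \<omega> * ((\<Prod>i\<in>D. h (B i \<omega>)) * (\<Prod>i\<in>?R. indicator {..y i} (B i \<omega>)))" for \<omega>
    define W' where "W' \<omega> = indicator {\<omega>. K \<omega> = n} \<omega> * ((\<Prod>i\<in>D. f (S i \<omega>)) * (\<Prod>i\<in>?R. emeasure (\<kappa> (S i \<omega>)) {..y i}))" for \<omega>
    have [measurable]: "W \<in> borel_measurable M" "W' \<in> borel_measurable M"
      unfolding W_def W'_def by measurable
    have "(\<integral>\<^sup>+\<omega>. W \<omega> * h (B j \<omega>) \<partial>M) = (\<integral>\<^sup>+\<omega>. W' \<omega> * (\<integral>\<^sup>+x. h x \<partial>\<kappa> (S j \<omega>)) \<partial>M)"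
    proof (rule nn_integral_kernel_eqI)
      \<comment> \<open>The bound \<open>h \<le> 1\<close> keeps both weighted measures finite, as
        their identification through distribution functions requires.\<close>
      show "(\<integral>\<^sup>+\<omega>. W \<omega> \<partial>M) < \<infinity>"
        by (rule bound) (auto simp: W_def indicator_def h1 intro!: mult_le_one prod_le_1)
      show "(\<integral>\<^sup>+\<omega>. W' \<omega> \<partial>M) < \<infinity>"
        by (rule bound) (auto simp: W'_def indicator_def f1 k1 intro!: mult_le_one prod_le_1)
      fix t
      \<comment> \<open>In the induction hypothesis the factor of \<open>j\<close> is still a
        half-line. Moving its endpoint to \<open>t\<close> produces the distribution functions to be
        compared, and the factors over \<open>?R\<close> do not notice the change.\<close>
      have R: "(\<Prod>i\<in>?R. indicator {..(y(j := t)) i} (B i \<omega>)) = (\<Prod>i\<in>?R. indicator {..y i} (B i \<omega>) :: ennreal)"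
        "(\<Prod>i\<in>?R. emeasure (\<kappa> (S i \<omega>)) {..(y(j := t)) i}) = (\<Prod>i\<in>?R. emeasure (\<kappa> (S i \<omega>)) {..y i})" for \<omega>
        by (auto intro!: prod.cong)
      have "(\<integral>\<^sup>+\<omega>. indicator {\<omega>. K \<omega> = n} \<omega> * ((\<Prod>i\<in>D. h (B i \<omega>)) * (\<Prod>i\<in>{..<n} - D. indicator {..(y(j := t)) i} (B i \<omega>))) \<partial>M)
        = (\<integral>\<^sup>+\<omega>. indicator {\<omega>. K \<omega> = n} \<omega> * ((\<Prod>i\<in>D. f (S i \<omega>)) * (\<Prod>i\<in>{..<n} - D. emeasure (\<kappa> (S i \<omega>)) {..(y(j := t)) i})) \<partial>M)"
        using insert by (intro insert.IH) auto
      moreover have "indicator {\<omega>. K \<omega> = n} \<omega> * ((\<Prod>i\<in>D. h (B i \<omega>)) * (\<Prod>i\<in>{..<n} - D. indicator {..(y(j := t)) i} (B i \<omega>)))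
        = W \<omega> * indicator {..t} (B j \<omega>)" for \<omega>
        unfolding j(2) W_def by (subst prod.insert) (auto simp only: R fun_upd_same, auto simp: mult_ac)
      moreover have "indicator {\<omega>. K \<omega> = n} \<omega> * ((\<Prod>i\<in>D. f (S i \<omega>)) * (\<Prod>i\<in>{..<n} - D. emeasure (\<kappa> (S i \<omega>)) {..(y(j := t)) i}))
        = W' \<omega> * emeasure (\<kappa> (S j \<omega>)) {..t}" for \<omega>
        unfolding j(2) W'_def by (subst prod.insert) (auto simp only: R fun_upd_same, auto simp: mult_ac)
      ultimately show "(\<integral>\<^sup>+\<omega>. W \<omega> * indicator {..t} (B j \<omega>) \<partial>M) = (\<integral>\<^sup>+\<omega>. W' \<omega> * emeasure (\<kappa> (S j \<omega>)) {..t} \<partial>M)"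
        by simp
    qed (auto simp: not_empty)
    moreover have "indicator {\<omega>. K \<omega> = n} \<omega> * ((\<Prod>i\<in>insert j D. h (B i \<omega>)) * (\<Prod>i\<in>?R. indicator {..y i} (B i \<omega>)))
      = W \<omega> * h (B j \<omega>)" for \<omega>
      using insert.hyps by (simp add: W_def mult_ac)
    moreover have "indicator {\<omega>. K \<omega> = n} \<omega> * ((\<Prod>i\<in>insert j D. f (S i \<omega>)) * (\<Prod>i\<in>?R. emeasure (\<kappa> (S i \<omega>)) {..y i}))
      = W' \<omega> * (\<integral>\<^sup>+x. h x \<partial>\<kappa> (S j \<omega>))" for \<omega>
      using insert.hyps by (simp add: W'_def mult_ac f_def)
    ultimately show ?case by simp
  qed
  from this[OF finite_lessThan order.refl] show ?thesis
    by (simp add: f_def)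
qed

lemma nn_integral_prod_marks:
  fixes h :: "real \<Rightarrow> ennreal"
  assumes h [measurable]: "h \<in> borel_measurable borel" and h1: "\<And>x. h x \<le> 1"
  shows "(\<integral>\<^sup>+\<omega>. (\<Prod>i<K \<omega>. h (B i \<omega>)) \<partial>M) = (\<integral>\<^sup>+\<omega>. (\<Prod>i<K \<omega>. \<integral>\<^sup>+x. h x \<partial>\<kappa> (S i \<omega>)) \<partial>M)"
proof -
  have split: "(\<integral>\<^sup>+\<omega>. \<Phi> (K \<omega>) \<omega> \<partial>M) = (\<Sum>n. \<integral>\<^sup>+\<omega>. indicator {\<omega>. K \<omega> = n} \<omega> * \<Phi> n \<omega> \<partial>M)"
    if [measurable]: "\<And>n. \<Phi> n \<in> borel_measurable M" for \<Phi> :: "nat \<Rightarrow> 'a \<Rightarrow> ennreal"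
  proof -
    have "(\<Sum>n. indicator {\<omega>. K \<omega> = n} \<omega> * \<Phi> n \<omega>) = (\<Sum>n\<in>{K \<omega>}. indicator {\<omega>. K \<omega> = n} \<omega> * \<Phi> n \<omega>)" for \<omega>
      by (intro suminf_finite) auto
    then have "(\<integral>\<^sup>+\<omega>. \<Phi> (K \<omega>) \<omega> \<partial>M) = (\<integral>\<^sup>+\<omega>. (\<Sum>n. indicator {\<omega>. K \<omega> = n} \<omega> * \<Phi> n \<omega>) \<partial>M)"
      by simp
    then show ?thesis by (subst (asm) nn_integral_suminf) auto
  qed
  show ?thesis
    using split[of "\<lambda>n \<omega>. \<Prod>i<n. h (B i \<omega>)"] split[of "\<lambda>n \<omega>. \<Prod>i<n. \<integral>\<^sup>+x. h x \<partial>\<kappa> (S i \<omega>)"]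
    by (simp add: nn_integral_prod_marks_given_count[OF h h1])
qed

lemma measurable_kernel_integral [measurable]:
  assumes [measurable]: "h \<in> borel_measurable borel"
  shows "(\<lambda>s. \<integral>x. h x \<partial>\<kappa> s :: real) \<in> borel_measurable borel"
  by measurable

lemma measurable_kernel_measure [measurable]:
  assumes [measurable]: "A \<in> sets borel"
  shows "(\<lambda>s. measure (\<kappa> s) A) \<in> borel_measurable borel"
  by measurable

lemma expectation_prod_marks:
  fixes h :: "real \<Rightarrow> real"
  assumes h [measurable]: "h \<in> borel_measurable borel" and h01: "\<And>x. h x \<in> {0..1}"
  shows "expectation (\<lambda>\<omega>. \<Prod>i<K \<omega>. h (B i \<omega>)) = expectation (\<lambda>\<omega>. \<Prod>i<K \<omega>. \<integral>x. h x \<partial>\<kappa> (S i \<omega>))"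
proof -
  have int: "integrable (\<kappa> s) h" for s
  proof -
    interpret k: prob_space "\<kappa> s" by (rule prob_space_kernel)
    show ?thesis by (rule k.integrable_const_bound[where B=1]) (use h01 in auto)
  qed
  have e: "ennreal (\<integral>x. h x \<partial>\<kappa> s) = (\<integral>\<^sup>+x. ennreal (h x) \<partial>\<kappa> s)" for s
    by (rule nn_integral_eq_integral[symmetric, OF int]) (use h01 in auto)
  have nonneg: "0 \<le> (\<integral>x. h x \<partial>\<kappa> s)" for s
    by (rule Bochner_Integration.integral_nonneg) (use h01 in auto)
  have "expectation (\<lambda>\<omega>. \<Prod>i<K \<omega>. h (B i \<omega>)) = enn2real (\<integral>\<^sup>+\<omega>. (\<Prod>i<K \<omega>. ennreal (h (B i \<omega>))) \<partial>M)"
    using h01 by (subst integral_eq_nn_integral) (auto intro!: prod_nonneg simp: prod_ennreal)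
  also have "\<dots> = enn2real (\<integral>\<^sup>+\<omega>. (\<Prod>i<K \<omega>. \<integral>\<^sup>+x. ennreal (h x) \<partial>\<kappa> (S i \<omega>)) \<partial>M)"
    using h01 by (subst nn_integral_prod_marks) auto
  also have "\<dots> = expectation (\<lambda>\<omega>. \<Prod>i<K \<omega>. \<integral>x. h x \<partial>\<kappa> (S i \<omega>))"
    using nonneg by (subst integral_eq_nn_integral) (auto intro!: prod_nonneg simp: prod_ennreal e[symmetric])
  finally show ?thesis .
qed

section \<open>Counts of marks in disjoint Borel sets\<close>

definition mark_mean :: "real set \<Rightarrow> real" where
  "mark_mean A = lam * (LINT s:{0..T}|lborel. measure (\<kappa> s) A)"

lemma mark_mean_nonneg: "0 \<le> mark_mean A"
  unfolding mark_mean_def set_lebesgue_integral_def using lam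
  by (intro mult_nonneg_nonneg Bochner_Integration.integral_nonneg) auto

lemma integrable_kernel_measure:
  assumes [measurable]: "A \<in> sets borel"
  shows "set_integrable lborel {0..T} (\<lambda>s. measure (\<kappa> s) A)"
  unfolding set_integrable_def
proof (rule Bochner_Integration.integrable_bound)
  show "integrable lborel (indicat_real {0..T})"
    using T by (intro integrable_real_indicator) auto
  show "AE s in lborel. norm (indicat_real {0..T} s *\<^sub>R measure (\<kappa> s) A) \<le> norm (indicat_real {0..T} s)"
    using prob_space.prob_le_1[OF prob_space_kernel] by (auto simp: indicator_def)
qed auto

lemma expectation_prod_pgf_marks:
  assumes I: "finite I" and d: "disjoint_family_on A I"
    and A [measurable]: "\<And>j. j \<in> I \<Longrightarrow> A j \<in> sets borel"
    and z: "\<And>j. j \<in> I \<Longrightarrow> z j \<in> {0..1}"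
  shows "expectation (\<lambda>\<omega>. \<Prod>j\<in>I. z j ^ point_count K B (A j) \<omega>) = (\<Prod>j\<in>I. exp (- (1 - z j) * mark_mean (A j)))"
proof -
  let ?h = "step_weight I A z"
  define f where "f s = (\<integral>x. ?h x \<partial>\<kappa> s)" for s
  have [measurable]: "?h \<in> borel_measurable borel" by (rule measurable_step_weight) (rule A)
  have h01: "?h x \<in> {0..1}" for x by (rule step_weight_mem) (rule z)
  have f: "1 - f s = (\<Sum>j\<in>I. (1 - z j) * measure (\<kappa> s) (A j))" and f01: "f s \<in> {0..1}" for s
  proof -
    interpret k: prob_space "\<kappa> s" by (rule prob_space_kernel)
    have int: "integrable (\<kappa> s) ?h"
      by (rule k.integrable_const_bound[where B=1]) (use h01 in auto)
    have "1 - f s = (\<integral>x. 1 - ?h x \<partial>\<kappa> s)"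
      unfolding f_def by (subst Bochner_Integration.integral_diff) (use int k.prob_space in auto)
    also have "\<dots> = (\<Sum>j\<in>I. (1 - z j) * measure (\<kappa> s) (A j))"
      unfolding one_minus_step_weight[OF I d]
      by (subst Bochner_Integration.integral_sum) (auto intro!: sum.cong A simp: k.emeasure_eq_measure)
    finally show "1 - f s = (\<Sum>j\<in>I. (1 - z j) * measure (\<kappa> s) (A j))" .
    have "0 \<le> 1 - f s" unfolding \<open>1 - f s = (\<Sum>j\<in>I. _ j)\<close> using z by (intro sum_nonneg mult_nonneg_nonneg) auto
    moreover have "0 \<le> f s" unfolding f_def by (rule Bochner_Integration.integral_nonneg) (use h01 in auto)
    ultimately show "f s \<in> {0..1}" by simp
  qed
  have "expectation (\<lambda>\<omega>. \<Prod>j\<in>I. z j ^ point_count K B (A j) \<omega>) = expectation (\<lambda>\<omega>. \<Prod>i<K \<omega>. ?h (B i \<omega>))"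
    by (simp add: prod_points_step_weight[OF I])
  also have "\<dots> = expectation (\<lambda>\<omega>. \<Prod>i<K \<omega>. f (S i \<omega>))"
    unfolding f_def by (rule expectation_prod_marks) (use h01 in auto)
  also have "\<dots> = exp (- lam * (LINT s:{0..T}|lborel. 1 - f s))"
  proof -
    have "f \<in> borel_measurable borel" unfolding f_def by measurable
    then have "has_poisson_functional f"
      by (rule has_poisson_functional_borel) (use f01 in auto)
    then show ?thesis by (simp add: has_poisson_functional_def)
  qed
  also have "(LINT s:{0..T}|lborel. 1 - f s) = (\<Sum>j\<in>I. (1 - z j) * (LINT s:{0..T}|lborel. measure (\<kappa> s) (A j)))"
    unfolding f set_lebesgue_integral_def scaleR_sum_right
    using integrable_kernel_measure[OF A]
    by (subst Bochner_Integration.integral_sum)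
      (auto simp: set_integrable_def mult.left_commute intro!: sum.cong)
  also have "exp (- lam * \<dots>) = (\<Prod>j\<in>I. exp (- (1 - z j) * mark_mean (A j)))"
    by (simp add: mark_mean_def exp_sum[OF I, symmetric] sum_distrib_left sum_negf algebra_simps)
  finally show ?thesis .
qed

lemma poisson_distributed_mark_count:
  assumes A [measurable]: "A \<in> sets borel"
  shows "poisson_distributed M (point_count K B A) (mark_mean A)"
proof (rule poisson_distributed_pgfI)
  show "expectation (\<lambda>\<omega>. z ^ point_count K B A \<omega>) = exp (- (1 - z) * mark_mean A)" if "z \<in> {0..1}" for z
    using expectation_prod_pgf_marks[of "{()}" "\<lambda>_. A" "\<lambda>_. z"] A that
    by (simp add: disjoint_family_on_def)
qed (auto simp: mark_mean_nonneg)

text \<open>Each factor of the joint generating function is already the generating function of one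
  marginal count, so the criterion for independence applies directly.\<close>

lemma indep_vars_mark_counts:
  assumes I: "finite I" and d: "disjoint_family_on A I"
    and A [measurable]: "\<And>j. j \<in> I \<Longrightarrow> A j \<in> sets borel"
  shows "indep_vars (\<lambda>_. count_space UNIV) (\<lambda>j. point_count K B (A j)) I"
proof (rule indep_vars_nat_pgfI[OF I])
  show "point_count K B (A j) \<in> measurable M (count_space UNIV)" if "j \<in> I" for j
    using A[OF that] by measurable
  show "expectation (\<lambda>\<omega>. \<Prod>j\<in>I. z j ^ point_count K B (A j) \<omega>)
      = (\<Prod>j\<in>I. expectation (\<lambda>\<omega>. z j ^ point_count K B (A j) \<omega>))"
    if "\<And>j. j \<in> I \<Longrightarrow> z j \<in> {0..1}" for z :: "_ \<Rightarrow> real"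
    using expectation_prod_pgf_marks[OF I d A that]
      poisson_distributed_pgf[OF poisson_distributed_mark_count[OF A] that]
    by simp
qed

lemma independent_increments_marks: "independent_increments M T (point_count K B)"
  unfolding independent_increments_def
proof (intro allI impI)
  fix n and J :: "nat \<Rightarrow> real set"
  assume J: "(\<forall>i<n. is_interval (J i) \<and> J i \<subseteq> {0..T}) \<and> disjoint_family_on J {..<n}"
  have "A \<in> sets borel" if A: "is_interval A" for A :: "real set"
  proof -
    have "\<exists>a b. A = {} \<or> A = UNIV \<or> A = {..<b} \<or> A = {..b} \<or> A = {a<..} \<or> A = {a..} \<or>
        A = {a<..<b} \<or> A = {a<..b} \<or> A = {a..<b} \<or> A = {a..b}"
      by (rule interval_cases) (use A in \<open>unfold is_interval_1, blast\<close>)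
    then show ?thesis by (elim exE disjE) simp_all
  qed
  then show "indep_vars (\<lambda>_. count_space UNIV) (\<lambda>i. point_count K B (J i)) {..<n}"
    using J by (intro indep_vars_mark_counts) auto
qed

end

section \<open>Bid times\<close>

text \<open>For \<open>s\<close> outside \<open>[0, T)\<close>, where \<open>G s\<close> is unconstrained, the kernel is an arbitrary point mass.\<close>

definition bid_kernel :: "real \<Rightarrow> (real \<Rightarrow> real \<Rightarrow> real) \<Rightarrow> real \<Rightarrow> real measure" where
  "bid_kernel T G s = (if s \<in> {0..<T}
    then SOME \<mu>. real_distribution \<mu> \<and> measure \<mu> {s..<T} = 1 \<and> G s = cdf \<mu> else return borel 0)"

context
  fixes T :: real and G :: "real \<Rightarrow> real \<Rightarrow> real"
  assumes G: "bid_time_cdfs T G"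
begin

lemma bid_kernel:
  assumes "s \<in> {0..<T}"
  shows "real_distribution (bid_kernel T G s)" "measure (bid_kernel T G s) {s..<T} = 1" "G s = cdf (bid_kernel T G s)"
proof -
  have "\<exists>\<mu>. real_distribution \<mu> \<and> measure \<mu> {s..<T} = 1 \<and> G s = cdf \<mu>"
    using G assms by (auto simp: bid_time_cdfs_def)
  from someI_ex[OF this] show "real_distribution (bid_kernel T G s)"
    "measure (bid_kernel T G s) {s..<T} = 1" "G s = cdf (bid_kernel T G s)"
    using assms by (simp_all add: bid_kernel_def)
qed

lemma prob_space_bid_kernel: "prob_space (bid_kernel T G s)"
  and sets_bid_kernel [simp]: "sets (bid_kernel T G s) = sets borel"
proof -
  have "prob_space (bid_kernel T G s) \<and> sets (bid_kernel T G s) = sets borel"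
  proof (cases "s \<in> {0..<T}")
    case True
    from bid_kernel(1)[OF this] show ?thesis
      by (simp add: real_distribution_def real_distribution_axioms_def)
  next
    case False
    show ?thesis
      unfolding bid_kernel_def if_not_P[OF False] by (simp add: prob_space_return)
  qed
  then show "prob_space (bid_kernel T G s)" "sets (bid_kernel T G s) = sets borel" by auto
qed

text \<open>The measures are chosen for each \<open>s\<close> separately, yet measurability in
  \<open>s\<close> has to be checked only on half-lines, an intersection-stable generator, and there
  the mass is \<open>G s y\<close>.\<close>

lemma measurable_bid_kernel: "bid_kernel T G \<in> borel \<rightarrow>\<^sub>M prob_algebra borel"
proof (rule measurable_prob_algebra_generated[where G="range (\<lambda>a. {..a})" and \<Omega>=UNIV])
  show "sets borel = sigma_sets UNIV (range (\<lambda>a::real. {..a}))"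
    by (subst borel_eq_atMost) simp
  show "Int_stable (range (\<lambda>a::real. {..a}))"
    by (auto simp: Int_stable_def)
  fix A :: "real set" assume "A \<in> range (\<lambda>a. {..a})"
  then obtain y where A: "A = {..y}" by auto
  have "(\<lambda>s. emeasure (bid_kernel T G s) A) = (\<lambda>s. if s \<in> {0..<T} then ennreal (G s y) else indicator A 0)"
  proof
    fix s
    interpret k: prob_space "bid_kernel T G s" by (rule prob_space_bid_kernel)
    show "emeasure (bid_kernel T G s) A = (if s \<in> {0..<T} then ennreal (G s y) else indicator A 0)"
    proof (cases "s \<in> {0..<T}")
      case True
      then show ?thesis
        unfolding bid_kernel(3)[OF True] by (simp add: A cdf_def k.emeasure_eq_measure)
    next
      case False
      show ?thesis
        unfolding bid_kernel_def if_not_P[OF False] by (simp add: A)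
    qed
  qed
  also have "\<dots> \<in> borel_measurable borel"
  proof (subst measurable_If_restrict_space_iff)
    have "(\<lambda>s. G s y) \<in> borel_measurable (restrict_space borel {0..<T})"
      using G by (simp add: bid_time_cdfs_def)
    then show "(\<lambda>s. ennreal (G s y)) \<in> borel_measurable (restrict_space borel {x. x \<in> {0..<T}}) \<and>
      (\<lambda>s. indicator A 0 :: ennreal) \<in> borel_measurable (restrict_space borel {x. x \<notin> {0..<T}})"
      by (simp del: atLeastLessThan_iff)
  qed simp
  finally show "(\<lambda>s. emeasure (bid_kernel T G s) A) \<in> borel_measurable borel" .
qed (auto simp: prob_space_bid_kernel)

lemma measure_bid_kernel_eq_0:
  assumes s: "s \<in> {0..<T}" and A: "A \<in> sets borel" "A \<inter> {s..<T} = {}"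
  shows "measure (bid_kernel T G s) A = 0"
proof -
  interpret k: real_distribution "bid_kernel T G s" by (rule bid_kernel(1)[OF s])
  have "measure (bid_kernel T G s) A \<le> measure (bid_kernel T G s) (space (bid_kernel T G s) - {s..<T})"
    using A by (intro k.finite_measure_mono) auto
  also have "\<dots> = 0"
    by (subst k.prob_compl) (auto simp: bid_kernel(2)[OF s])
  finally show ?thesis by (simp add: measure_le_0_iff)
qed

text \<open>No mass lies before the arrival time. Hence arrivals after \<open>y\<close> contribute
  nothing, which is why the mean in the theorem integrates over arrivals up to \<open>y\<close>
  only.\<close>

lemma measure_bid_kernel_atLeastAtMost:
  assumes s: "s \<in> {0..<T}"
  shows "measure (bid_kernel T G s) {0..y} = (if s \<le> y then G s y else 0)"
proof (cases "s \<le> y")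
  case True
  interpret k: real_distribution "bid_kernel T G s" by (rule bid_kernel(1)[OF s])
  have "{..y} = {..<0} \<union> {0..y}" using True s by auto
  then have "G s y = measure (bid_kernel T G s) {..<0} + measure (bid_kernel T G s) {0..y}"
    unfolding bid_kernel(3)[OF s] cdf_def
    by (simp only:, intro k.finite_measure_Union) auto
  moreover have "measure (bid_kernel T G s) {..<0} = 0"
    by (rule measure_bid_kernel_eq_0[OF s]) (use s in auto)
  ultimately show ?thesis
    using True by simp
next
  case False
  then have "measure (bid_kernel T G s) {0..y} = 0"
    by (intro measure_bid_kernel_eq_0[OF s]) auto
  then show ?thesis using False by simp
qed

lemma measure_bid_kernel_greaterThanAtMost:
  assumes s: "s \<in> {0..<T}" and uv: "u \<le> v"
  shows "measure (bid_kernel T G s) {u<..v} = G s v - G s u"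
proof -
  interpret k: real_distribution "bid_kernel T G s" by (rule bid_kernel(1)[OF s])
  show ?thesis
    using uv k.cdf_diff_eq[of u v] unfolding bid_kernel(3)[OF s] by (cases "u = v") auto
qed

lemma bid_cdf_eq_0:
  assumes s: "s \<in> {0..<T}" and y: "y < s"
  shows "G s y = 0"
  unfolding bid_kernel(3)[OF s] cdf_def
  by (rule measure_bid_kernel_eq_0[OF s]) (use y in auto)

end

section \<open>Densities and the intensity of the bid process\<close>

text \<open>The density \<open>g s t\<close>, cut down to the pairs \<open>s \<le> t\<close> for which it is constrained.\<close>

definition truncated_density :: "real \<Rightarrow> (real \<Rightarrow> real \<Rightarrow> real) \<Rightarrow> real \<Rightarrow> real \<Rightarrow> real" where
  "truncated_density T g s t = (if 0 \<le> s \<and> s < T \<and> s \<le> t \<and> t \<le> T then g s t else 0)"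

context
  fixes T :: real and G g :: "real \<Rightarrow> real \<Rightarrow> real"
  assumes T: "0 < T" and G: "bid_time_cdfs T G" and g: "bid_time_densities T G g"
begin

lemma measurable_truncated_density [measurable]:
  "case_prod (truncated_density T g) \<in> borel_measurable (lborel \<Otimes>\<^sub>M lborel)"
proof -
  have "(\<lambda>(s, t). g s t) \<in> borel_measurable (restrict_space (borel \<Otimes>\<^sub>M borel) ({0..T} \<times> {0..T}))"
    using g by (simp add: bid_time_densities_def)
  then have [measurable]: "(\<lambda>x. indicator ({0..T} \<times> {0..T}) x *\<^sub>R (case x of (s, t) \<Rightarrow> g s t))
      \<in> borel_measurable (borel \<Otimes>\<^sub>M borel)"
    by (subst (asm) borel_measurable_restrict_space_iff) auto
  \<comment> \<open>\<open>g\<close> is measurable only on the square, so it is extended by 0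
    through the indicator, which also supplies the bounds \<open>0 \<le> s\<close> and
    \<open>t \<le> T\<close>; the \<open>if\<close> supplies the other two.\<close>
  have "case_prod (truncated_density T g) = (\<lambda>x. if fst x < T \<and> fst x \<le> snd x
      then indicator ({0..T} \<times> {0..T}) x *\<^sub>R (case x of (s, t) \<Rightarrow> g s t) else 0)"
    by (auto simp: fun_eq_iff truncated_density_def indicator_def)
  also have "\<dots> \<in> borel_measurable (borel \<Otimes>\<^sub>M borel)"
    by measurable
  finally show ?thesis
    by (simp cong: measurable_cong_sets sets_pair_measure_cong)
qed

lemma truncated_density_nonneg: "0 \<le> truncated_density T g s t"
  using g by (auto simp: truncated_density_def bid_time_densities_def)

lemma integrable_truncated_density: "integrable lborel (truncated_density T g s)"
proof (cases "s \<in> {0..<T}")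
  case True
  then have "set_integrable lborel {s..T} (g s)"
    using g by (auto simp: bid_time_densities_def)
  moreover have "(\<lambda>t. indicator {s..T} t *\<^sub>R g s t) = truncated_density T g s"
    using True by (auto simp: truncated_density_def indicator_def)
  ultimately show ?thesis by (simp add: set_integrable_def)
next
  case False
  then have "truncated_density T g s = (\<lambda>_. 0)" by (auto simp: truncated_density_def fun_eq_iff)
  then show ?thesis by simp
qed

lemma LINT_truncated_density_atMost:
  assumes s: "s \<in> {0..<T}" and y: "y \<le> T"
  shows "(LINT t:{..y}|lborel. truncated_density T g s t) = G s y"
proof (cases "s \<le> y")
  case True
  have "G s y = (LINT t:{s..y}|lborel. g s t)"
    using g s y True by (auto simp: bid_time_densities_def)
  also have "\<dots> = (LINT t:{..y}|lborel. truncated_density T g s t)"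
    unfolding set_lebesgue_integral_def using s y
    by (intro Bochner_Integration.integral_cong) (auto simp: truncated_density_def indicator_def)
  finally show ?thesis by simp
next
  case False
  then have "(LINT t:{..y}|lborel. truncated_density T g s t) = (LINT (t::real)|lborel. 0)"
    unfolding set_lebesgue_integral_def
    by (intro Bochner_Integration.integral_cong) (auto simp: truncated_density_def indicator_def)
  then show ?thesis using False s bid_cdf_eq_0[OF G] by simp
qed

lemma LINT_truncated_density:
  assumes s: "s \<in> {0..<T}" and uv: "u \<le> v" "v \<le> T"
  shows "(LINT t:{u<..v}|lborel. truncated_density T g s t) = measure (bid_kernel T G s) {u<..v}"
proof -
  have int: "set_integrable lborel A (truncated_density T g s)" if "A \<in> sets borel" for A
    unfolding set_integrable_def using that
    by (intro integrable_mult_indicator integrable_truncated_density) auto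
  have "{..v} = {..u} \<union> {u<..v}" using uv by auto
  then have "(LINT t:{..v}|lborel. truncated_density T g s t)
      = (LINT t:{..u}|lborel. truncated_density T g s t) + (LINT t:{u<..v}|lborel. truncated_density T g s t)"
    by (simp only:, intro set_integral_Un int) auto
  then show ?thesis
    using uv s by (simp add: LINT_truncated_density_atMost measure_bid_kernel_greaterThanAtMost[OF G])
qed

text \<open>For \<open>s\<close> in [0, T) the density integrates to \<open>G s T = 1\<close>, so
  the double integral is the length \<open>T\<close> of the time interval.\<close>

lemma integrable_truncated_density_pair:
  "integrable (lborel \<Otimes>\<^sub>M lborel) (case_prod (truncated_density T g))"
proof (rule lborel_pair.Fubini_integrable)
  have eq: "(\<integral>t. norm (case_prod (truncated_density T g) (s, t)) \<partial>lborel) = indicator {0..<T} s" for s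
  proof (cases "s \<in> {0..<T}")
    case True
    have "(\<integral>t. norm (case_prod (truncated_density T g) (s, t)) \<partial>lborel) = (LINT t:{..T}|lborel. truncated_density T g s t)"
      unfolding set_lebesgue_integral_def
      by (intro Bochner_Integration.integral_cong refl)
        (simp add: truncated_density_nonneg, simp add: truncated_density_def)
    also have "\<dots> = G s T" using True by (simp add: LINT_truncated_density_atMost)
    also have "\<dots> = 1"
    proof -
      interpret k: real_distribution "bid_kernel T G s" by (rule bid_kernel(1)[OF G True])
      have "measure (bid_kernel T G s) {s..<T} \<le> measure (bid_kernel T G s) {..T}"
        by (intro k.finite_measure_mono) auto
      then show ?thesis
        using k.prob_le_1[of "{..T}"] bid_kernel(2,3)[OF G True] by (simp add: cdf_def)
    qed
    finally show ?thesis using True by simp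
  next
    case False
    then show ?thesis by (auto simp: truncated_density_def)
  qed
  show "integrable lborel (\<lambda>s. \<integral>t. norm (case_prod (truncated_density T g) (s, t)) \<partial>lborel)"
    unfolding eq using T by (intro integrable_real_indicator) auto
qed (auto simp: integrable_truncated_density)

text \<open>For \<open>t < T\<close> the range \<open>{0..t}\<close> misses \<open>s = T\<close>,
  the point at which truncation could change the integrand.\<close>

lemma LINT_density_eq_truncated:
  assumes "t \<in> {0..<T}"
  shows "(LINT s:{0..t}|lborel. g s t) = (LINT s|lborel. truncated_density T g s t)"
  unfolding set_lebesgue_integral_def using assms
  by (intro Bochner_Integration.integral_cong) (auto simp: truncated_density_def indicator_def)

text \<open>An intensity has to be nonnegative at every time, also at \<open>t = T\<close>, where
  the range contains \<open>s = T\<close>. The sign of \<open>g\<close> is unknown at that point,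
  which is dropped as a null set.\<close>

lemma LINT_density_nonneg:
  assumes "t \<in> {0..T}"
  shows "0 \<le> (LINT s:{0..t}|lborel. g s t)"
  unfolding set_lebesgue_integral_def
proof (rule integral_nonneg_AE)
  have "AE s in lborel. s \<noteq> T" by (rule AE_lborel_singleton)
  then show "AE s in lborel. 0 \<le> indicator {0..t} s *\<^sub>R g s t"
  proof eventually_elim
    case (elim s)
    then show ?case using assms g by (auto simp: indicator_def bid_time_densities_def)
  qed
qed

text \<open>Fubini: integrating the density over \<open>{u<..v}\<close> before integrating over the
  arrival time yields the kernel mass of that interval. Multiplied by \<open>lam\<close>, the result
  is the mean number of bids there.\<close>

lemma
  shows set_integrable_density: "set_integrable lborel {0..T} (\<lambda>t. LINT s:{0..t}|lborel. g s t)"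
    and LINT_LINT_density: "\<And>u v. 0 \<le> u \<Longrightarrow> u \<le> v \<Longrightarrow> v \<le> T \<Longrightarrow>
      (LINT t:{u..v}|lborel. LINT s:{0..t}|lborel. g s t) = (LINT s:{0..T}|lborel. measure (bid_kernel T G s) {u<..v})"
proof -
  let ?l = "\<lambda>t. LINT s:{0..t}|lborel. g s t"
  let ?m = "\<lambda>t. LINT s|lborel. truncated_density T g s t"
  have int: "integrable lborel ?m"
    using lborel_pair.integrable_snd[OF integrable_truncated_density_pair] by simp
  \<comment> \<open>Agreement of \<open>?l\<close> and \<open>?m\<close> almost everywhere would not
    make \<open>?l\<close> Borel, as \<open>lborel\<close> is not complete. An equation at every
    \<open>t\<close> in [0, T], with the value at \<open>T\<close> split off, does.\<close>
  have l: "?l t = (if t = T then ?l T else ?m t)" if "t \<in> {0..T}" for t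
    using that by (auto simp: LINT_density_eq_truncated)
  \<comment> \<open>The discarded points are \<open>u\<close>, where \<open>{u..v}\<close> and
    \<open>{u<..v}\<close> differ, and \<open>T\<close>, where \<open>?l\<close> and
    \<open>?m\<close> may differ.\<close>
  have AE: "AE t in lborel. t \<noteq> u \<and> t \<noteq> T" for u
    using AE_lborel_singleton[of u] AE_lborel_singleton[of T] by eventually_elim simp
  have meas: "(\<lambda>t. indicator {u..v} t *\<^sub>R ?l t) \<in> borel_measurable lborel" if "0 \<le> u" "v \<le> T" for u v
  proof -
    have "(\<lambda>t. indicator {u..v} t *\<^sub>R ?l t) = (\<lambda>t. indicator {u..v} t *\<^sub>R (if t = T then ?l T else ?m t))"
      using that l by (fastforce simp: fun_eq_iff indicator_def)
    also have "\<dots> \<in> borel_measurable lborel"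
      using borel_measurable_integrable[OF int] by measurable
    finally show ?thesis .
  qed
  have eq: "AE t in lborel. indicator {u..v} t *\<^sub>R ?l t = indicator {u<..v} t *\<^sub>R ?m t" if "0 \<le> u" "v \<le> T" for u v
    using AE[of u]
  proof eventually_elim
    case (elim t)
    then show ?case
      using that by (auto simp: indicator_def LINT_density_eq_truncated)
  qed
  have int': "integrable lborel (\<lambda>t. indicator {u<..v} t *\<^sub>R ?m t)" for u v
    using int by (intro integrable_mult_indicator) auto
  show "set_integrable lborel {0..T} ?l"
    unfolding set_integrable_def
    using integrable_cong_AE[OF meas _ eq, of 0 T] int'[of 0 T] by auto
  fix u v assume uv: "0 \<le> u" "u \<le> v" "v \<le> T"
  have "(LINT t:{u..v}|lborel. ?l t) = (LINT t|lborel. indicator {u..v} t *\<^sub>R ?l t)"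
    by (simp only: set_lebesgue_integral_def)
  also have "\<dots> = (LINT t|lborel. indicator {u<..v} t *\<^sub>R ?m t)"
    by (rule integral_cong_AE[OF meas _ eq]) (use uv int'[of u v] in auto)
  also have "\<dots> = (LINT t|lborel. (LINT s|lborel. indicator {u<..v} t *\<^sub>R truncated_density T g s t))"
    by simp
  also have "\<dots> = (LINT s|lborel. (LINT t|lborel. indicator {u<..v} t *\<^sub>R truncated_density T g s t))"
  proof (rule lborel_pair.Fubini_integral)
    have "integrable (lborel \<Otimes>\<^sub>M lborel) (\<lambda>x. indicator (UNIV \<times> {u<..v}) x *\<^sub>R case_prod (truncated_density T g) x)"
      by (intro integrable_mult_indicator integrable_truncated_density_pair) auto
    then show "integrable (lborel \<Otimes>\<^sub>M lborel) (\<lambda>(s, t). indicator {u<..v} t *\<^sub>R truncated_density T g s t)"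
      by (rule Bochner_Integration.integrable_cong[THEN iffD1, rotated -1]) (auto simp: indicator_def)
  qed
  also have "\<dots> = (LINT s:{0..T}|lborel. measure (bid_kernel T G s) {u<..v})"
    unfolding set_lebesgue_integral_def
  proof (rule integral_cong_AE)
    have "(\<lambda>s. measure (bid_kernel T G s) {u<..v}) \<in> borel_measurable borel"
      using measurable_prob_algebraD[OF measurable_bid_kernel[OF G]] by measurable
    then show "(\<lambda>s. indicator {0..T} s *\<^sub>R measure (bid_kernel T G s) {u<..v}) \<in> borel_measurable lborel"
      by measurable
    have "AE s in lborel. s \<noteq> T" by (rule AE_lborel_singleton)
    then show "AE s in lborel. (LINT t|lborel. indicator {u<..v} t *\<^sub>R truncated_density T g s t)
        = indicator {0..T} s *\<^sub>R measure (bid_kernel T G s) {u<..v}"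
    proof eventually_elim
      case (elim s)
      show ?case
      proof (cases "s \<in> {0..<T}")
        case True
        then show ?thesis
          using LINT_truncated_density[OF True uv(2,3)] by (simp add: set_lebesgue_integral_def)
      next
        case False
        then have "truncated_density T g s t = 0" for t by (auto simp: truncated_density_def)
        then show ?thesis using False elim by auto
      qed
    qed
    show "(\<lambda>s. LINT t|lborel. indicator {u<..v} t *\<^sub>R truncated_density T g s t) \<in> borel_measurable lborel"
      by measurable
  qed
  finally show "(LINT t:{u..v}|lborel. ?l t) = (LINT s:{0..T}|lborel. measure (bid_kernel T G s) {u<..v})" .
qed

end

text \<open>The event \<open>K = n\<close> belongs to the information in the arrival times, so the
  conditional expectation may be integrated over it, and on it the random product has length
  \<open>n\<close>.\<close>

lemma (in poisson_arrivals) marked_poisson_arrivals_bid_kernel: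
  assumes B [measurable]: "\<And>i. B i \<in> borel_measurable M"
    and G: "bid_time_cdfs T G"
    and bids: "conditionally_independent_bids M K S B G"
  shows "marked_poisson_arrivals M T lam K S B (bid_kernel T G)"
proof unfold_locales
  let ?F = "arrival_sigma M K S"
  let ?\<kappa> = "bid_kernel T G"
  show "bid_kernel T G \<in> borel \<rightarrow>\<^sub>M prob_algebra borel" by (rule measurable_bid_kernel[OF G])
  fix n :: nat and y :: "nat \<Rightarrow> real"
  have gen: "{{\<omega> \<in> space M. i < K \<omega> \<and> S i \<omega> \<in> A} | i A. A \<in> sets borel} \<subseteq> sets M"
    by auto
  then have sp: "{{\<omega> \<in> space M. i < K \<omega> \<and> S i \<omega> \<in> A} | i A. A \<in> sets borel} \<subseteq> Pow (space M)"
    by auto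
  have sets_F: "sets ?F = sigma_sets (space M) {{\<omega> \<in> space M. i < K \<omega> \<and> S i \<omega> \<in> A} | i A. A \<in> sets borel}"
    and space_F: "space ?F = space M"
    using sp by (auto simp: arrival_sigma_def)
  have "subalgebra M ?F"
    unfolding subalgebra_def sets_F space_F using sets.sigma_sets_subset[OF gen] by simp
  then interpret F: finite_measure_subalgebra M ?F
    by unfold_locales
  have less: "{\<omega> \<in> space M. i < K \<omega>} \<in> sets ?F" for i
    unfolding sets_F by (rule sigma_sets.Basic) (auto intro!: exI[of _ i] exI[of _ UNIV])
  define E where "E = {\<omega> \<in> space M. K \<omega> = n}"
  have E: "E \<in> sets ?F"
  \<comment> \<open>For positive \<open>n\<close> the event is the difference of
    \<open>n - 1 < K\<close> and \<open>n < K\<close>; for \<open>n = 0\<close> the whole space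
    takes the place of the former.\<close>
  proof (cases n)
    case 0
    then have "E = space ?F - {\<omega> \<in> space M. 0 < K \<omega>}" by (auto simp: E_def space_F)
    then show ?thesis using less[of 0] by simp
  next
    case (Suc m)
    then have "E = {\<omega> \<in> space M. m < K \<omega>} - {\<omega> \<in> space M. n < K \<omega>}" by (auto simp: E_def)
    then show ?thesis using less by simp
  qed
  define D where "D = {\<omega> \<in> space M. \<forall>i<K \<omega>. B i \<omega> \<le> y i}"
  have D [measurable]: "D \<in> sets M"
    unfolding D_def by measurable
  have E' [measurable]: "E \<in> sets M" unfolding E_def by measurable
  have em: "(\<lambda>s. measure (?\<kappa> s) {..y i}) \<in> borel_measurable borel" for i
    using measurable_prob_algebraD[OF measurable_bid_kernel[OF G]] by measurable
  have "(\<integral>\<^sup>+\<omega>. indicator {\<omega>. K \<omega> = n} \<omega> * (\<Prod>i<n. indicator {..y i} (B i \<omega>)) \<partial>M)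
      = (\<integral>\<^sup>+\<omega>. ennreal (indicator E \<omega> * indicator D \<omega>) \<partial>M)"
  proof (rule nn_integral_cong)
    fix \<omega> assume \<omega>: "\<omega> \<in> space M"
    have "(\<Prod>i<n. indicator {..y i} (B i \<omega>) :: ennreal) = indicator {\<omega>. \<forall>i<n. B i \<omega> \<le> y i} \<omega>"
      by (cases "\<forall>i<n. B i \<omega> \<le> y i") (auto simp: indicator_def prod_zero_iff)
    then show "indicator {\<omega>. K \<omega> = n} \<omega> * (\<Prod>i<n. indicator {..y i} (B i \<omega>)) = ennreal (indicator E \<omega> * indicator D \<omega>)"
      using \<omega> by (auto simp: E_def D_def indicator_def)
  qed
  also have "\<dots> = ennreal (\<integral>\<omega>. indicator E \<omega> * indicator D \<omega> \<partial>M)"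
    by (rule nn_integral_eq_integral) (auto intro!: integrable_const_bound[where B=1] simp: indicator_def)
  also have "(\<integral>\<omega>. indicator E \<omega> * indicator D \<omega> \<partial>M) = (\<integral>\<omega>. indicator E \<omega> * real_cond_exp M ?F (indicator D) \<omega> \<partial>M)"
  proof -
    have "integrable M (indicat_real D)"
      using D by (intro integrable_real_indicator) (auto simp: emeasure_eq_measure)
    from F.real_cond_exp_intA[OF this E] show ?thesis
      by (simp add: set_lebesgue_integral_def)
  qed
  also have "\<dots> = (\<integral>\<omega>. indicator E \<omega> * (\<Prod>i<n. measure (?\<kappa> (S i \<omega>)) {..y i}) \<partial>M)"
  proof (rule integral_cong_AE)
    have "AE \<omega> in M. real_cond_exp M ?F (indicator D) \<omega> = (\<Prod>i<K \<omega>. G (S i \<omega>) (y i))"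
      using bids by (simp add: conditionally_independent_bids_def D_def)
    \<comment> \<open>At an arrival time \<open>T\<close> the value \<open>G T\<close> and the
      default kernel could disagree; almost surely there is no such arrival.\<close>
    moreover have "AE \<omega> in M. \<forall>i<K \<omega>. S i \<omega> \<notin> {T}"
      by (rule AE_arrival_notin_null_set) (simp add: finite_imp_null_set_lborel)
    ultimately show "AE \<omega> in M. indicator E \<omega> * real_cond_exp M ?F (indicator D) \<omega>
        = indicator E \<omega> * (\<Prod>i<n. measure (?\<kappa> (S i \<omega>)) {..y i})"
      using AE_arrival_pos
    proof eventually_elim
      case (elim \<omega>)
      have "G (S i \<omega>) (y i) = measure (?\<kappa> (S i \<omega>)) {..y i}" if "i < K \<omega>" for i
      proof -
        have "S i \<omega> \<in> {0..<T}" using elim(2,3) that by force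
        then show ?thesis by (simp add: bid_kernel(3)[OF G] cdf_def)
      qed
      then show ?case using elim(1) by (auto simp: E_def indicator_def)
    qed
  qed (use em in measurable)
  also have "ennreal \<dots> = (\<integral>\<^sup>+\<omega>. ennreal (indicator E \<omega> * (\<Prod>i<n. measure (?\<kappa> (S i \<omega>)) {..y i})) \<partial>M)"
  proof (rule nn_integral_eq_integral[symmetric])
    have "0 \<le> (\<Prod>i<n. measure (?\<kappa> (S i \<omega>)) {..y i}) \<and> (\<Prod>i<n. measure (?\<kappa> (S i \<omega>)) {..y i}) \<le> 1" for \<omega>
      using prob_space.prob_le_1[OF prob_space_bid_kernel[OF G]] by (auto intro!: prod_nonneg prod_le_1)
    then show "integrable M (\<lambda>\<omega>. indicator E \<omega> * (\<Prod>i<n. measure (?\<kappa> (S i \<omega>)) {..y i}))"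
      using em by (intro integrable_const_bound[where B=1]) (auto simp: indicator_def)
  qed (auto intro!: prod_nonneg mult_nonneg_nonneg)
  also have "\<dots> = (\<integral>\<^sup>+\<omega>. indicator {\<omega>. K \<omega> = n} \<omega> * (\<Prod>i<n. emeasure (?\<kappa> (S i \<omega>)) {..y i}) \<partial>M)"
    using finite_measure.emeasure_eq_measure[OF prob_space.finite_measure[OF prob_space_bid_kernel[OF G]]]
    by (intro nn_integral_cong) (auto simp: E_def indicator_def prod_ennreal)
  finally show "(\<integral>\<^sup>+\<omega>. indicator {\<omega>. K \<omega> = n} \<omega> * (\<Prod>i<n. indicator {..y i} (B i \<omega>)) \<partial>M)
      = (\<integral>\<^sup>+\<omega>. indicator {\<omega>. K \<omega> = n} \<omega> * (\<Prod>i<n. emeasure (?\<kappa> (S i \<omega>)) {..y i}) \<partial>M)" .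
qed (rule B)

theorem mainTheorem1:
  fixes M :: "'a measure" and T lam :: real
    and K :: "'a \<Rightarrow> nat" and S B :: "nat \<Rightarrow> 'a \<Rightarrow> real"
    and G :: "real \<Rightarrow> real \<Rightarrow> real"
  assumes "prob_space M" and "0 < T" and "0 < lam"
    and "K \<in> measurable M (count_space UNIV)"
    and "\<And>i. S i \<in> borel_measurable M"
    and "\<And>i. B i \<in> borel_measurable M"
    and "\<And>i \<omega>. \<omega> \<in> space M \<Longrightarrow> i < K \<omega> \<Longrightarrow> S i \<omega> \<in> {0..T}"
    and "poisson_process M T (\<lambda>_. lam) (point_count K S)"
    and "bid_time_cdfs T G"
    and "conditionally_independent_bids M K S B G"
  shows "independent_increments M T (point_count K B)
    \<and> (\<forall>y\<in>{0..T}. poisson_distributed M (point_count K B {0..y})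
          (LINT s:{0..y}|lborel. lam * G s y))
    \<and> (\<forall>g. bid_time_densities T G g \<longrightarrow>
          poisson_process M T (\<lambda>t. lam * (LINT s:{0..t}|lborel. g s t)) (point_count K B))"
proof -
  interpret poisson_arrivals M T lam K S
    by (intro poisson_arrivals.intro poisson_arrivals_axioms.intro) (fact assms)+
  interpret marked_poisson_arrivals M T lam K S B "bid_kernel T G"
    by (rule marked_poisson_arrivals_bid_kernel) (use assms in auto)
  note G = \<open>bid_time_cdfs T G\<close>
  have AE_T: "AE s in lborel. s \<noteq> T" by (rule AE_lborel_singleton)
  have mean_cdf: "mark_mean {0..y} = (LINT s:{0..y}|lborel. lam * G s y)" if y: "y \<in> {0..T}" for y
  proof -
    have "(LINT s:{0..y}|lborel. lam * G s y) = lam * (LINT s:{0..y}|lborel. G s y)"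
      by simp
    also have "(LINT s:{0..y}|lborel. G s y) = (LINT s:{0..T}|lborel. measure (bid_kernel T G s) {0..y})"
      unfolding set_lebesgue_integral_def
    proof (rule integral_cong_AE)
      \<comment> \<open>For \<open>y = T\<close> the integral includes \<open>s = T\<close>, where
        \<open>G T\<close> is arbitrary. Isolating this one value as \<open>c\<close> gives an
        equation at every \<open>s\<close>, and with it Borel measurability.\<close>
      define c where "c = indicator {0..y} T *\<^sub>R G T y"
      have eq: "indicator {0..y} s *\<^sub>R G s y = (if s = T then c
          else indicator {0..T} s *\<^sub>R measure (bid_kernel T G s) {0..y})" for s
        using y measure_bid_kernel_atLeastAtMost[OF G, of s y] by (auto simp: indicator_def c_def)
      show "(\<lambda>s. indicator {0..y} s *\<^sub>R G s y) \<in> borel_measurable lborel"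
        unfolding eq by measurable
      show "AE s in lborel. indicator {0..y} s *\<^sub>R G s y = indicator {0..T} s *\<^sub>R measure (bid_kernel T G s) {0..y}"
        using AE_T by eventually_elim (simp only: eq if_False)
    qed measurable
    finally show ?thesis unfolding mark_mean_def by (rule sym)
  qed
  \<comment> \<open>Only a bidder arriving at time 0 can bid at time 0, since the bid time is at
    least the arrival time; this single \<open>s\<close> does not affect the integral.\<close>
  have "mark_mean {0} = 0"
  proof -
    have "(LINT s:{0..T}|lborel. measure (bid_kernel T G s) {0}) = (LINT (s::real)|lborel. 0 :: real)"
      unfolding set_lebesgue_integral_def
    proof (rule integral_cong_AE)
      show "AE s in lborel. indicator {0..T} s *\<^sub>R measure (bid_kernel T G s) {0} = (0 :: real)"
        using AE_T AE_lborel_singleton[of 0]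
      proof eventually_elim
        case (elim s)
        then show ?case
          using measure_bid_kernel_eq_0[OF G, of s "{0}"] by (auto simp: indicator_def)
      qed
    qed measurable
    then show ?thesis by (simp add: mark_mean_def)
  qed
  then have "prob {\<omega> \<in> space M. point_count K B {0} \<omega> = 0} = 1"
    using poisson_distributed_mark_count[of "{0}"] by (simp add: poisson_distributed_def)
  then have zero: "AE \<omega> in M. point_count K B {0} \<omega> = 0"
    by (rule AE_prob_1[THEN eventually_mono]) simp
  have density: "poisson_process M T (\<lambda>t. lam * (LINT s:{0..t}|lborel. g s t)) (point_count K B)"
    if g: "bid_time_densities T G g" for g
    unfolding poisson_process_def
  proof (intro conjI allI impI ballI)
    fix t assume "t \<in> {0..T}"
    then show "0 \<le> lam * (LINT s:{0..t}|lborel. g s t)"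
      using LINT_density_nonneg[OF T G g] lam by simp
  next
    show "set_integrable lborel {0..T} (\<lambda>t. lam * (LINT s:{0..t}|lborel. g s t))"
      using set_integrable_density[OF T G g] by simp
  next
    fix u v assume "0 \<le> u \<and> u \<le> v \<and> v \<le> T"
    then have "mark_mean {u<..v} = (LINT t:{u..v}|lborel. lam * (LINT s:{0..t}|lborel. g s t))"
      using LINT_LINT_density[OF T G g, of u v] by (simp add: mark_mean_def)
    then show "poisson_distributed M (point_count K B {u<..v}) (LINT t:{u..v}|lborel. lam * (LINT s:{0..t}|lborel. g s t))"
      using poisson_distributed_mark_count[of "{u<..v}"] by simp
  qed (rule zero independent_increments_marks)+
  have "poisson_distributed M (point_count K B {0..y}) (LINT s:{0..y}|lborel. lam * G s y)" if "y \<in> {0..T}" for y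
    unfolding mean_cdf[OF that, symmetric] by (rule poisson_distributed_mark_count) simp
  with independent_increments_marks density show ?thesis by blast
qed

end
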